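(* Let $m,n,k$ be non-negative integers with $k\le n$ and let $b_1<\dots<b_k$ be positive integers with $b_k\le m+k$. The number of $(m,n,k)$-Gog trapezoids with bottom row $(b_1,\dots,b_k)$ is the constant term in $x_1,\dots,x_n$ of $$\prod_{i=1}^k(1+x_i)^{b_i}x_i^{-n+1}\prod_{i=k+1}^n(1+x_i)^{m+k+1}x_i^{-n+i-k}\prod_{1\le i<j\le n}(x_i-x_j)(1+x_j+x_ix_j).$$ In particular, since for $m=0$ the bottom row is necessarily $(1,2,\dots,k)$, the number of $(0,n,k)$-Gog trapezoids is the constant term of $$\prod_{i=1}^k(1+x_i)^{i}x_i^{-n+1}\prod_{i=k+1}^n(1+x_i)^{k+1}x_i^{-n+i-k}\prod_{1\le i<j\le n}(x_i-x_j)(1+x_j+x_ix_j).$$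
   Context: For non-negative integers $m,n,k$ with $k\le n$, an $(m,n,k)$-Gog trapezoid is an array $(m_{i,j})$ of positive integers indexed by $1\le i\le n$, $1\le j\le\min(i,k)$ (arranged like the $k$ leftmost NE-diagonals of a triangular array with $n$ rows, row $i$ on top of row $i+1$, with $m_{i,j}$ between $m_{i+1,j}$ and $m_{i+1,j+1}$), such that $m_{i+1,j}\le m_{i,j}$ and $m_{i,j}\le m_{i+1,j+1}$ whenever the entries exist (weak increase along NE- and SE-diagonals), rows are strictly increasing ($m_{i,j}<m_{i,j+1}$), and each entry $m_{i,j}$ is at most $m+n-i+j$ (the entries of the $s$-th SE-diagonal from the left, i.e. those with $n-(i-j)=s$, are bounded by $m+s$). The bottom row is $(m_{n,1},\dots,m_{n,k})$. *)

theory Defs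
  imports "HOL-Library.Poly_Mapping"
begin

text \<open>Entries outside the index region are set to zero, so that distinct functions represent
  distinct arrays.  The subtraction \<open>m + n - i\<close> does not truncate because \<open>i \<le> n\<close>.\<close>

definition gog_trapezoids :: "nat \<Rightarrow> nat \<Rightarrow> nat \<Rightarrow> (nat \<Rightarrow> nat \<Rightarrow> nat) set" where
  "gog_trapezoids m n k = {M.
     (\<forall>i j. \<not> (1 \<le> i \<and> i \<le> n \<and> 1 \<le> j \<and> j \<le> min i k) \<longrightarrow> M i j = 0) \<and>
     (\<forall>i j. 1 \<le> i \<and> i \<le> n \<and> 1 \<le> j \<and> j \<le> min i k \<longrightarrow> 0 < M i j \<and> M i j \<le> m + n - i + j) \<and>
     (\<forall>i j. 1 \<le> i \<and> i < n \<and> 1 \<le> j \<and> j \<le> min i k \<longrightarrow> M (i + 1) j \<le> M i j) \<and>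
     (\<forall>i j. 1 \<le> i \<and> i < n \<and> 1 \<le> j \<and> j \<le> min i k \<and> j + 1 \<le> min (i + 1) k \<longrightarrow>
        M i j \<le> M (i + 1) (j + 1)) \<and>
     (\<forall>i j. 1 \<le> i \<and> i \<le> n \<and> 1 \<le> j \<and> j + 1 \<le> min i k \<longrightarrow> M i j < M i (j + 1))}"

lemma finite_gog_trapezoids: "finite (gog_trapezoids m n k)"
proof -
  let ?R = "{g :: nat \<Rightarrow> nat. \<forall>j. (j \<in> {1..k} \<longrightarrow> g j \<in> {0..m + n + k}) \<and> (j \<notin> {1..k} \<longrightarrow> g j = 0)}"
  let ?A = "{f. \<forall>i. (i \<in> {1..n} \<longrightarrow> f i \<in> ?R) \<and> (i \<notin> {1..n} \<longrightarrow> f i = (\<lambda>_. 0))}"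
  have R: "finite ?R"
    by (rule finite_set_of_finite_funs) auto
  have A: "finite ?A"
    using R by (intro finite_set_of_finite_funs) auto
  have "M i j \<le> m + n + k" if "M \<in> gog_trapezoids m n k" for M i j
  proof (cases "1 \<le> i \<and> i \<le> n \<and> 1 \<le> j \<and> j \<le> min i k")
    case True
    then have "M i j \<le> m + n - i + j"
      using that unfolding gog_trapezoids_def by blast
    then show ?thesis using True by linarith
  next
    case False
    then have "M i j = 0"
      using that unfolding gog_trapezoids_def by blast
    then show ?thesis by simp
  qed
  moreover have "M i j = 0" if "M \<in> gog_trapezoids m n k" "i \<notin> {1..n} \<or> j \<notin> {1..k}" for M i j
    using that unfolding gog_trapezoids_def by auto
  ultimately have "gog_trapezoids m n k \<subseteq> ?A"
    by (auto intro!: ext)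
  then show ?thesis
    using A finite_subset by blast
qed

text \<open>Integer Laurent polynomials in variables indexed by the naturals: the group ring over the
  finitely supported integer exponent vectors, with the convolution product of
  \<^theory>\<open>HOL-Library.Poly_Mapping\<close>.\<close>

type_synonym laurent_mpoly = "(nat \<Rightarrow>\<^sub>0 int) \<Rightarrow>\<^sub>0 int"

definition xpow :: "nat \<Rightarrow> int \<Rightarrow> laurent_mpoly" where
  "xpow i e = Poly_Mapping.single (Poly_Mapping.single i e) 1"

definition X :: "nat \<Rightarrow> laurent_mpoly" where
  "X i = xpow i 1"

definition constant_term :: "laurent_mpoly \<Rightarrow> int" where
  "constant_term p = Poly_Mapping.lookup p 0"

lemma xpow_0: "xpow i 0 = 1"
  by (simp add: xpow_def)

lemma xpow_add: "xpow i (a + b) = xpow i a * xpow i b"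
  by (simp add: xpow_def mult_single single_add)

lemma xpow_inverse: "xpow i e * xpow i (- e) = 1"
  by (simp flip: xpow_add add: xpow_0)

lemma xpow_of_nat: "xpow i (int e) = X i ^ e"
  by (induction e) (simp_all add: xpow_0 xpow_add X_def)

end

theory Submission
  imports Defs "HOL-Combinatorics.Transposition"
begin

text \<open>Write \<open>y\<^sub>i = 1 + x\<^sub>i\<close> and \<open>v\<^sub>i\<^sub>j = 1 + x\<^sub>j + x\<^sub>i x\<^sub>j\<close>.  The proof is by induction on the number \<open>n\<close> of rows: deleting the
  bottom row of an \<open>(m, n, k)\<close>-trapezoid leaves an \<open>(m + 1, n - 1, min k (n - 1))\<close>-trapezoid whose bottom
  row \<open>l\<close> strictly increases and interlaces \<open>(b\<^sub>1, \<dots>, b\<^sub>k, m + k + 1)\<close>.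

  On the constant term side, expand the Vandermonde product \<open>\<Prod>(x\<^sub>i - x\<^sub>j)\<close> along the highest power.  In
  the \<open>p\<close>-th summand the variable \<open>x\<^sub>p\<close> has no negative exponent, so it may be set to \<open>0\<close>; then \<open>v\<^sub>i\<^sub>p\<close>
  becomes \<open>1\<close> and \<open>v\<^sub>p\<^sub>j\<close> becomes \<open>y\<^sub>j\<close>, which leaves an alternating sum over \<open>p\<close> of constant terms in
  \<open>n - 1\<close> variables.  On the other hand, summing \<open>\<Prod>y\<^sub>i^l\<^sub>i\<close> over the interlacing rows \<open>l\<close> gives
  geometric sums corrected by inclusion-exclusion at the coincidences \<open>l\<^sub>i = b\<^sub>i\<^sub>+\<^sub>1 = l\<^sub>i\<^sub>+\<^sub>1\<close>.  The two
  agree up to multiples of \<open>v\<^sub>i\<^sub>+\<^sub>1\<^sub>,\<^sub>i\<close> by factors symmetric in \<open>x\<^sub>i, x\<^sub>i\<^sub>+\<^sub>1\<close>, and these do not contribute because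
  \<open>v\<^sub>i\<^sub>,\<^sub>i\<^sub>+\<^sub>1 v\<^sub>i\<^sub>+\<^sub>1\<^sub>,\<^sub>i (x\<^sub>i - x\<^sub>i\<^sub>+\<^sub>1)\<close> is antisymmetric.\<close>

section \<open>Renaming of variables and substitution of zero\<close>

text \<open>The inner \<open>map_key\<close> pulls exponent vectors back along \<open>f\<close>, the
  outer one pulls coefficients back along that map. The two reversals cancel, so \<open>X i\<close>
  goes to \<open>X (f i)\<close>. Injectivity of the inner map on exponent vectors comes from
  surjectivity of \<open>f\<close>, hence the assumption \<open>bij f\<close> throughout.\<close>

definition rename :: "(nat \<Rightarrow> nat) \<Rightarrow> laurent_mpoly \<Rightarrow> laurent_mpoly" where
  "rename f p = Poly_Mapping.map_key (Poly_Mapping.map_key f) p"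

lemma inj_map_key:
  assumes "bij f"
  shows "inj (Poly_Mapping.map_key f :: (nat \<Rightarrow>\<^sub>0 int) \<Rightarrow> _)"
proof (rule injI, rule poly_mapping_eqI)
  fix p q :: "nat \<Rightarrow>\<^sub>0 int" and k
  assume "Poly_Mapping.map_key f p = Poly_Mapping.map_key f q"
  moreover have "inj f" using assms by (rule bij_is_inj)
  ultimately have "Poly_Mapping.lookup p (f j) = Poly_Mapping.lookup q (f j)" for j
    by (metis map_key.rep_eq comp_apply)
  from this[of "inv f k"] show "Poly_Mapping.lookup p k = Poly_Mapping.lookup q k"
    using assms by (simp add: bij_is_surj surj_f_inv_f)
qed

lemma lookup_rename:
  assumes "bij f"
  shows "Poly_Mapping.lookup (rename f p) e = Poly_Mapping.lookup p (Poly_Mapping.map_key f e)"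
  using inj_map_key[OF assms] by (simp add: rename_def map_key.rep_eq)

lemma rename_add: "bij f \<Longrightarrow> rename f (p + q) = rename f p + rename f q"
  by (simp add: rename_def map_key_plus inj_map_key)

lemma rename_diff: "bij f \<Longrightarrow> rename f (p - q) = rename f p - rename f q"
  by (rule poly_mapping_eqI) (simp add: lookup_rename lookup_minus)

lemma rename_uminus: "bij f \<Longrightarrow> rename f (- p) = - rename f p"
  by (rule poly_mapping_eqI) (simp add: lookup_rename)

lemma rename_zero: "bij f \<Longrightarrow> rename f 0 = 0"
  by (rule poly_mapping_eqI) (simp add: lookup_rename)

lemma map_key_inv_map_key:
  assumes "bij f"
  shows "Poly_Mapping.map_key f (Poly_Mapping.map_key (inv f) e) = e"
  using assms by (intro poly_mapping_eqI) (simp add: map_key.rep_eq bij_is_inj bij_imp_bij_inv)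

lemma rename_single:
  assumes "bij f"
  shows "rename f (Poly_Mapping.single e c) =
    Poly_Mapping.single (Poly_Mapping.map_key (inv f) e) c"
  using map_key_single[OF inj_map_key[OF assms], of "Poly_Mapping.map_key (inv f) e" c]
  by (simp add: rename_def map_key_inv_map_key assms)

text \<open>On monomials \<open>frag_of\<close> this is additivity of \<open>map_key\<close>.
  Laurent polynomials are integer combinations of monomials, so \<open>frag_induction\<close>
  extends the claim first in the right and then in the left factor.\<close>

lemma rename_mult:
  assumes f: "bij f"
  shows "rename f (p * q) = rename f p * rename f q"
proof -
  have g: "inj (inv f)" using f by (simp add: bij_imp_bij_inv bij_is_inj)
  have single: "rename f (frag_of d * frag_of e) = rename f (frag_of d) * rename f (frag_of e)" for d e
    using g by (simp add: mult_single rename_single[OF f] map_key_plus)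
  have left: "rename f (frag_of d * q) = rename f (frag_of d) * rename f q" for d
    by (rule frag_induction[of q UNIV])
      (simp_all add: rename_zero[OF f] single right_diff_distrib rename_diff[OF f])
  show ?thesis
    by (rule frag_induction[of p UNIV])
      (simp_all add: rename_zero[OF f] left left_diff_distrib rename_diff[OF f])
qed

lemma rename_xpow:
  assumes f: "bij f"
  shows "rename f (xpow i e) = xpow (f i) e"
proof -
  have "Poly_Mapping.map_key (inv f) (Poly_Mapping.single (inv f (f i)) e) = Poly_Mapping.single (f i) e"
    if "inv f (f i) = i"
    by (rule map_key_single) (simp add: bij_imp_bij_inv[OF f] bij_is_inj)
  then show ?thesis
    using f by (simp add: xpow_def rename_single bij_is_inj)
qed

lemma rename_X: "bij f \<Longrightarrow> rename f (X i) = X (f i)"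
  by (simp add: X_def rename_xpow)

lemma rename_one: "bij f \<Longrightarrow> rename f 1 = 1"
  using rename_xpow[of f 0 0] by (simp add: xpow_0)

lemma rename_power: "bij f \<Longrightarrow> rename f (p ^ n) = rename f p ^ n"
  by (induction n) (simp_all add: rename_one rename_mult)

lemma rename_prod: "bij f \<Longrightarrow> rename f (prod g A) = (\<Prod>a\<in>A. rename f (g a))"
  by (induction A rule: infinite_finite_induct) (simp_all add: rename_one rename_mult)

lemma rename_sum: "bij f \<Longrightarrow> rename f (sum g A) = (\<Sum>a\<in>A. rename f (g a))"
  by (induction A rule: infinite_finite_induct) (simp_all add: rename_zero rename_add)

lemmas rename_simps = rename_uminus rename_add rename_diff rename_zero rename_mult rename_xpow rename_X
  rename_one rename_power rename_prod rename_sum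

lemma constant_term_rename: "bij f \<Longrightarrow> constant_term (rename f p) = constant_term p"
  by (simp add: constant_term_def lookup_rename bij_is_inj)

lemma constant_term_diff: "constant_term (p - q) = constant_term p - constant_term q"
  by (simp add: constant_term_def lookup_minus)

lemma constant_term_uminus: "constant_term (- p) = - constant_term p"
  by (simp add: constant_term_def)

lemma constant_term_sum: "constant_term (sum g A) = (\<Sum>a\<in>A. constant_term (g a))"
  by (simp add: constant_term_def lookup_sum)

lemma constant_term_sign: "constant_term ((- 1) ^ k * p) = (- 1) ^ k * constant_term p"
  by (induction k) (simp_all add: constant_term_uminus)

lemma constant_term_eq_0_if_antisym:
  assumes "bij f" "rename f p = - p"
  shows "constant_term p = 0"
  using constant_term_rename[OF assms(1), of p] assms(2) by (simp add: constant_term_uminus)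

lemma inj_X: "X i = X j \<longleftrightarrow> i = j"
  by (auto simp: X_def xpow_def dest!: arg_cong[of _ _ Poly_Mapping.keys])

section \<open>Order of vanishing in one variable, and reduction modulo that variable\<close>

definition vanish_ord :: "nat \<Rightarrow> int \<Rightarrow> laurent_mpoly \<Rightarrow> bool" where
  "vanish_ord p d h \<longleftrightarrow> (\<forall>e\<in>Poly_Mapping.keys h. d \<le> Poly_Mapping.lookup e p)"

lemma vanish_ord_mono: "vanish_ord p d h \<Longrightarrow> d' \<le> d \<Longrightarrow> vanish_ord p d' h"
  by (auto simp: vanish_ord_def)

lemma vanish_ord_add: "vanish_ord p d g \<Longrightarrow> vanish_ord p d h \<Longrightarrow> vanish_ord p d (g + h)"
  using Poly_Mapping.keys_add[of g h] by (auto simp: vanish_ord_def)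

lemma vanish_ord_uminus: "vanish_ord p d (- h) \<longleftrightarrow> vanish_ord p d h"
  by (simp add: vanish_ord_def)

lemma vanish_ord_diff: "vanish_ord p d g \<Longrightarrow> vanish_ord p d h \<Longrightarrow> vanish_ord p d (g - h)"
  using vanish_ord_add[of p d g "- h"] by (simp add: vanish_ord_uminus)

lemma vanish_ord_mult:
  "vanish_ord p c g \<Longrightarrow> vanish_ord p d h \<Longrightarrow> vanish_ord p (c + d) (g * h)"
  using Poly_Mapping.keys_mult[of g h] by (fastforce simp: vanish_ord_def lookup_add)

lemma vanish_ord_xpow: "vanish_ord p (if i = p then e else 0) (xpow i e)"
  by (simp add: vanish_ord_def xpow_def lookup_single)

lemma vanish_ord_X: "vanish_ord p (if i = p then 1 else 0) (X i)"
  using vanish_ord_xpow[of p i 1] by (simp add: X_def)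

lemma vanish_ord_X0: "vanish_ord p 0 (X i)"
  by (rule vanish_ord_mono[OF vanish_ord_X]) simp

lemma vanish_ord_one: "vanish_ord p 0 1"
  using vanish_ord_xpow[of p p 0] by (simp add: xpow_0)

lemma vanish_ord_mult0: "vanish_ord p 0 g \<Longrightarrow> vanish_ord p 0 h \<Longrightarrow> vanish_ord p 0 (g * h)"
  using vanish_ord_mult[of p 0 g 0 h] by simp

lemma vanish_ord_power0: "vanish_ord p 0 g \<Longrightarrow> vanish_ord p 0 (g ^ n)"
  by (induction n) (simp_all add: vanish_ord_one vanish_ord_mult0)

lemma vanish_ord_prod0: "(\<And>a. a \<in> A \<Longrightarrow> vanish_ord p 0 (g a)) \<Longrightarrow> vanish_ord p 0 (prod g A)"
  by (induction A rule: infinite_finite_induct) (simp_all add: vanish_ord_one vanish_ord_mult0)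

lemma constant_term_eq_0_if_vanish_ord: "vanish_ord p 1 h \<Longrightarrow> constant_term h = 0"
  by (force simp: vanish_ord_def constant_term_def in_keys_iff)

text \<open>Congruence of Laurent polynomials without negative powers of \<open>X p\<close> modulo \<open>X p\<close>,
  that is, equality after the substitution \<open>X p = 0\<close>.\<close>

definition cong_at_0 :: "nat \<Rightarrow> laurent_mpoly \<Rightarrow> laurent_mpoly \<Rightarrow> bool" where
  "cong_at_0 p g h \<longleftrightarrow> vanish_ord p 0 g \<and> vanish_ord p 0 h \<and> vanish_ord p 1 (g - h)"

lemma cong_at_0_refl: "vanish_ord p 0 g \<Longrightarrow> cong_at_0 p g g"
  by (simp add: cong_at_0_def) (simp add: vanish_ord_def)

lemma cong_at_0_mult:
  assumes "cong_at_0 p g h" "cong_at_0 p g' h'"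
  shows "cong_at_0 p (g * g') (h * h')"
proof -
  have "g * g' - h * h' = (g - h) * g' + h * (g' - h')" by (simp add: algebra_simps)
  moreover have "vanish_ord p (1 + 0) ((g - h) * g')" "vanish_ord p (0 + 1) (h * (g' - h'))"
    using assms unfolding cong_at_0_def by (blast intro: vanish_ord_mult)+
  ultimately show ?thesis
    using assms by (auto simp: cong_at_0_def intro: vanish_ord_mult0 vanish_ord_add)
qed

lemma cong_at_0_power: "cong_at_0 p g h \<Longrightarrow> cong_at_0 p (g ^ n) (h ^ n)"
  by (induction n) (simp_all add: cong_at_0_refl vanish_ord_one cong_at_0_mult)

lemma cong_at_0_prod:
  "(\<And>a. a \<in> A \<Longrightarrow> cong_at_0 p (g a) (h a)) \<Longrightarrow> cong_at_0 p (prod g A) (prod h A)"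
  by (induction A rule: infinite_finite_induct)
    (simp_all add: cong_at_0_refl vanish_ord_one cong_at_0_mult)

lemma constant_term_cong_at_0: "cong_at_0 p g h \<Longrightarrow> constant_term g = constant_term h"
  using constant_term_eq_0_if_vanish_ord[of p "g - h"] by (simp add: cong_at_0_def constant_term_diff)

section \<open>Laplace expansion of the Vandermonde product\<close>

definition ordered_pairs :: "nat set \<Rightarrow> (nat \<times> nat) set" where
  "ordered_pairs S = {(i, j). i \<in> S \<and> j \<in> S \<and> i < j}"

lemma finite_pairs: "finite S \<Longrightarrow> finite (ordered_pairs S)"
  by (rule finite_subset[of _ "S \<times> S"]) (auto simp: ordered_pairs_def)

lemma prod_pairs_remove:
  fixes f :: "nat \<Rightarrow> nat \<Rightarrow> 'a :: comm_monoid_mult"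
  assumes "finite S" "p \<in> S"
  shows "(\<Prod>(i, j)\<in>ordered_pairs S. f i j) =
    (\<Prod>(i, j)\<in>ordered_pairs (S - {p}). f i j) * ((\<Prod>i | i \<in> S \<and> i < p. f i p) * (\<Prod>j | j \<in> S \<and> p < j. f p j))"
proof -
  let ?A = "(\<lambda>i. (i, p)) ` {i. i \<in> S \<and> i < p}" and ?B = "(\<lambda>j. (p, j)) ` {j. j \<in> S \<and> p < j}"
  let ?F = "\<lambda>(i, j). f i j"
  have fin: "finite (ordered_pairs (S - {p}))" "finite ?A" "finite ?B"
    using assms(1) by (simp_all add: finite_pairs)
  have disj: "ordered_pairs (S - {p}) \<inter> (?A \<union> ?B) = {}" "?A \<inter> ?B = {}"
    by (auto simp: ordered_pairs_def)
  have "ordered_pairs S = ordered_pairs (S - {p}) \<union> (?A \<union> ?B)"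
    using assms(2) by (auto simp: ordered_pairs_def)
  then have "prod ?F (ordered_pairs S) = prod ?F (ordered_pairs (S - {p})) * (prod ?F ?A * prod ?F ?B)"
    using fin disj by (simp only: prod.union_disjoint finite_UnI)
  moreover have "prod ?F ?A = (\<Prod>i | i \<in> S \<and> i < p. f i p)" "prod ?F ?B = (\<Prod>j | j \<in> S \<and> p < j. f p j)"
    by (simp_all add: prod.reindex inj_on_def)
  ultimately show ?thesis by simp
qed

definition vander :: "(nat \<Rightarrow> 'a :: comm_ring_1) \<Rightarrow> nat set \<Rightarrow> 'a" where
  "vander x S = (\<Prod>(i, j)\<in>ordered_pairs S. x i - x j)"

definition vander_quot :: "(nat \<Rightarrow> 'a :: comm_ring_1) \<Rightarrow> nat set \<Rightarrow> nat \<Rightarrow> 'a" where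
  "vander_quot x S q = (\<Prod>i | i \<in> S \<and> i < q. x i - x q) * (\<Prod>j | j \<in> S \<and> q < j. x q - x j)"

definition laplace_sign :: "nat set \<Rightarrow> nat \<Rightarrow> 'a :: comm_ring_1" where
  "laplace_sign S p = (- 1) ^ card {i \<in> S. i < p}"

text \<open>With \<open>N = card S - 1\<close>, this is the expansion along the first column of the
  determinant with columns \<open>x^d, x^(N-1), ..., x, 1\<close>. It is thus expected to be the
  Vandermonde product for \<open>d = N\<close> and zero for \<open>d < N\<close>, where two columns
  coincide. The proofs below avoid determinants.\<close>

definition laplace_sum :: "(nat \<Rightarrow> 'a :: comm_ring_1) \<Rightarrow> nat set \<Rightarrow> nat \<Rightarrow> 'a" where
  "laplace_sum x S d = (\<Sum>p\<in>S. laplace_sign S p * x p ^ d * vander x (S - {p}))"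

lemma vander_remove: "finite S \<Longrightarrow> q \<in> S \<Longrightarrow> vander x S = vander x (S - {q}) * vander_quot x S q"
  unfolding vander_def vander_quot_def by (rule prod_pairs_remove)

text \<open>Removing \<open>p\<close> from \<open>S\<close> loses one factor of the quotient at
  \<open>q\<close>. For \<open>p < q\<close> it is \<open>x p - x q\<close> and the sign is
  unchanged; for \<open>q < p\<close> it is \<open>x q - x p\<close>, and dropping \<open>q\<close>
  flips the sign of \<open>p\<close>.\<close>

lemma vander_quot_remove:
  assumes S: "finite S" and p: "p \<in> S" and "q \<in> S" "p \<noteq> q"
  shows "(x p - x q) * laplace_sign S p * vander_quot x (S - {p}) q =
    laplace_sign (S - {q}) p * vander_quot x S q"
proof (cases "p < q")
  case True
  have "{i \<in> S. i < q} = insert p {i \<in> S - {p}. i < q}" "{j \<in> S. q < j} = {j \<in> S - {p}. q < j}"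
    "{i \<in> S - {q}. i < p} = {i \<in> S. i < p}"
    using True p by auto
  then show ?thesis
    using S by (simp add: vander_quot_def laplace_sign_def)
next
  case False
  then have "q < p" using assms(4) by simp
  then have "{j \<in> S. q < j} = insert p {j \<in> S - {p}. q < j}" "{i \<in> S. i < q} = {i \<in> S - {p}. i < q}"
    "{i \<in> S. i < p} = insert q {i \<in> S - {q}. i < p}"
    using p assms(3) by auto
  then show ?thesis
    using S by (simp add: vander_quot_def laplace_sign_def algebra_simps)
qed

text \<open>Subtracting \<open>x q\<close> times the sum puts a factor \<open>x p - x q\<close> into
  every summand. This kills \<open>p = q\<close>, and in the other summands it completes the
  quotient at \<open>q\<close>, which then factors out.\<close>

lemma laplace_sum_Suc:
  assumes "finite S" "q \<in> S"
  shows "laplace_sum x S (Suc d) = x q * laplace_sum x S d + vander_quot x S q * laplace_sum x (S - {q}) d"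
proof -
  have "laplace_sum x S (Suc d) - x q * laplace_sum x S d =
      (\<Sum>p\<in>S. (x p - x q) * laplace_sign S p * x p ^ d * vander x (S - {p}))"
    by (simp add: laplace_sum_def sum_distrib_left algebra_simps flip: sum_subtractf)
  also have "\<dots> = (\<Sum>p\<in>S - {q}. (x p - x q) * laplace_sign S p * x p ^ d * vander x (S - {p}))"
    using assms by (simp add: sum.remove[of S q])
  also have "\<dots> = (\<Sum>p\<in>S - {q}. vander_quot x S q * (laplace_sign (S - {q}) p * x p ^ d * vander x (S - {q} - {p})))"
  proof (rule sum.cong)
    fix p assume p: "p \<in> S - {q}"
    have "vander x (S - {p}) = vander x (S - {q} - {p}) * vander_quot x (S - {p}) q"
      using assms p vander_remove[of "S - {p}" q x] by (simp add: Diff_insert2[symmetric] insert_commute)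
    then have "(x p - x q) * laplace_sign S p * x p ^ d * vander x (S - {p}) =
      ((x p - x q) * laplace_sign S p * vander_quot x (S - {p}) q) * x p ^ d * vander x (S - {q} - {p})"
      by (simp only: ac_simps)
    also have "(x p - x q) * laplace_sign S p * vander_quot x (S - {p}) q =
        laplace_sign (S - {q}) p * vander_quot x S q"
      using assms p by (intro vander_quot_remove) auto
    finally show "(x p - x q) * laplace_sign S p * x p ^ d * vander x (S - {p}) =
      vander_quot x S q * (laplace_sign (S - {q}) p * x p ^ d * vander x (S - {q} - {p}))"
      by (simp only: ac_simps)
  qed simp
  also have "\<dots> = vander_quot x S q * laplace_sum x (S - {q}) d"
    by (simp add: laplace_sum_def sum_distrib_left)
  finally show ?thesis by (simp add: algebra_simps)
qed

lemma vander_singleton: "vander x {p} = 1"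
proof -
  have "ordered_pairs {p} = {}" by (auto simp: ordered_pairs_def)
  then show ?thesis by (simp add: vander_def)
qed

lemma laplace_sum_singleton: "laplace_sum (x :: nat \<Rightarrow> 'a :: comm_ring_1) {p} 0 = 1"
proof -
  have "{i \<in> {p}. i < p} = {}" by auto
  then have "laplace_sign {p} p = (1 :: 'a)" by (simp only: laplace_sign_def) simp
  moreover have "vander x ({p} - {p}) = 1" by (simp add: vander_def ordered_pairs_def)
  ultimately show ?thesis by (simp add: laplace_sum_def)
qed

text \<open>Induction on the size of \<open>S\<close>. The recursion lifts the vanishing from
  \<open>d\<close> to \<open>Suc d\<close>, so the real case is \<open>d = 0\<close>: two variables
  cancel directly, and for more variables two choices of \<open>q\<close> in the recursion are
  compared.\<close>

lemma laplace_sum_eq_0: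
  fixes x :: "nat \<Rightarrow> 'a :: idom"
  assumes "finite S" "inj_on x S" "Suc d < card S"
  shows "laplace_sum x S d = 0"
  using assms
proof (induction "card S" arbitrary: S d rule: less_induct)
  case less
  note S = less.prems
  have remove: "laplace_sum x (S - {q}) d' = 0" if "q \<in> S" "Suc d' < card S - 1" for q d'
    using that S by (intro less.hyps) (auto intro: inj_on_diff)
  have zero: "laplace_sum x S 0 = 0"
  proof -
    have "2 \<le> card S" using S by simp
    then obtain A where "A \<subseteq> S" "card A = 2" by (rule obtain_subset_with_card_n)
    then obtain u v where "u \<in> S" "v \<in> S" "u \<noteq> v" by (auto simp: card_2_iff)
    then obtain q q' where q: "q \<in> S" "q' \<in> S" "q < q'"
      by (cases "u < v") (auto simp: not_less)
    show ?thesis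
    proof (cases "card S = 2")
      case True
      then have eq: "S = {q, q'}"
        using q S(1) by (intro card_seteq[symmetric]) auto
      have "{i \<in> {q, q'}. i < q'} = {q}" "{i \<in> {q, q'}. i < q} = {}"
        using q by auto
      moreover have "{q, q'} - {q} = {q'}" "{q, q'} - {q'} = {q}" using q by auto
      ultimately show ?thesis
        using q unfolding eq laplace_sum_def laplace_sign_def by (simp add: vander_singleton del: Collect_empty_eq)
    next
      case False
      \<comment> \<open>At least three elements leave at least two after removing \<open>p\<close>,
        so the second term of the recursion vanishes by induction. The left side is independent of
        \<open>p\<close>, and distinct values \<open>x q\<close>, \<open>x q'\<close> force the sum
        to be zero.\<close>
      then have "laplace_sum x S (Suc 0) = x p * laplace_sum x S 0" if "p \<in> S" for p
        using that S \<open>2 \<le> card S\<close> by (simp only: laplace_sum_Suc) (simp add: remove)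
      from this[OF q(1)] this[OF q(2)] have "x q * laplace_sum x S 0 = x q' * laplace_sum x S 0"
        by (rule trans[OF sym])
      then have "(x q - x q') * laplace_sum x S 0 = 0"
        by (simp only: left_diff_distrib diff_self)
      moreover have "x q \<noteq> x q'" using q S(2) by (auto dest: inj_onD)
      ultimately show ?thesis by simp
    qed
  qed
  from S(3) show ?case
  proof (induction d)
    case 0
    show ?case by (rule zero)
  next
    case (Suc d)
    then obtain q where "q \<in> S" by (metis card.empty less_zeroE equals0I)
    then have "laplace_sum x S (Suc d) = x q * laplace_sum x S d + vander_quot x S q * laplace_sum x (S - {q}) d"
      using S(1) by (rule laplace_sum_Suc[rotated])
    moreover have "laplace_sum x (S - {q}) d = 0"
      using Suc.prems \<open>q \<in> S\<close> by (intro remove) auto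
    moreover have "laplace_sum x S d = 0"
      using Suc.prems by (intro Suc.IH) simp
    ultimately show ?case by simp
  qed
qed

lemma laplace_sum_eq_vander:
  fixes x :: "nat \<Rightarrow> 'a :: idom"
  assumes "finite S" "inj_on x S" "card S = Suc N"
  shows "laplace_sum x S N = vander x S"
  using assms
proof (induction N arbitrary: S)
  case 0
  then obtain p where "S = {p}" by (auto simp: card_1_singleton_iff)
  then show ?case by (simp add: laplace_sum_singleton vander_singleton)
next
  case (Suc N)
  then obtain q where q: "q \<in> S" by fastforce
  have "laplace_sum x (S - {q}) N = vander x (S - {q})"
    using Suc q by (intro Suc.IH) (auto intro: inj_on_diff)
  then show ?case
    using Suc.prems q by (simp add: laplace_sum_Suc[of S q] laplace_sum_eq_0 vander_remove[of S q x])
qed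

lemma vander_laplace:
  fixes x :: "nat \<Rightarrow> 'a :: idom"
  assumes "inj_on x {1..Suc N}"
  shows "vander x {1..Suc N} = (\<Sum>p=1..Suc N. (- 1) ^ (p - 1) * x p ^ N * vander x ({1..Suc N} - {p}))"
proof -
  have "card {i \<in> {1..Suc N}. i < p} = p - 1" if "p \<in> {1..Suc N}" for p
  proof -
    have "{i \<in> {1..Suc N}. i < p} = {1..<p}" using that by auto
    then show ?thesis by simp
  qed
  then have "laplace_sum x {1..Suc N} N =
      (\<Sum>p=1..Suc N. (- 1) ^ (p - 1) * x p ^ N * vander x ({1..Suc N} - {p}))"
    unfolding laplace_sum_def laplace_sign_def by (intro sum.cong) simp_all
  with laplace_sum_eq_vander[OF _ assms] show ?thesis by simp
qed

section \<open>Elimination of a variable\<close>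

text \<open>This is \<open>v\<^sub>i\<^sub>j\<close> of the overview; it is not symmetric in
  \<open>i\<close> and \<open>j\<close>.\<close>

definition quad :: "nat \<Rightarrow> nat \<Rightarrow> laurent_mpoly" where
  "quad i j = 1 + X j + X i * X j"

definition pair_kernel :: "nat set \<Rightarrow> laurent_mpoly" where
  "pair_kernel S = vander X S * (\<Prod>(i, j)\<in>ordered_pairs S. quad i j)"

definition weight :: "(nat \<Rightarrow> nat) \<Rightarrow> (nat \<Rightarrow> int) \<Rightarrow> nat set \<Rightarrow> laurent_mpoly" where
  "weight a e S = (\<Prod>i\<in>S. (1 + X i) ^ a i * xpow i (e i))"

text \<open>Both exponent families are arbitrary because eliminating a variable changes them; the
  formula to be proved is the case \<open>bottom_ext\<close>, \<open>bottom_exp\<close>.\<close>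

definition weighted_ct :: "nat \<Rightarrow> (nat \<Rightarrow> nat) \<Rightarrow> (nat \<Rightarrow> int) \<Rightarrow> int" where
  "weighted_ct N a e = constant_term (weight a e {1..N} * pair_kernel {1..N})"

lemma rename_quad: "bij f \<Longrightarrow> rename f (quad i j) = quad (f i) (f j)"
  by (simp add: quad_def rename_simps)

lemma prod_pairs_reindex:
  assumes "strict_mono_on A f"
  shows "(\<Prod>(i, j)\<in>ordered_pairs (f ` A). g i j) = (\<Prod>(i, j)\<in>ordered_pairs A. g (f i) (f j))"
proof -
  have "ordered_pairs (f ` A) = map_prod f f ` ordered_pairs A"
    using assms by (auto simp: ordered_pairs_def strict_mono_on_less image_iff)
  moreover have "inj_on (map_prod f f) (ordered_pairs A)"
    using strict_mono_on_imp_inj_on[OF assms] by (auto simp: ordered_pairs_def inj_on_def)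
  ultimately show ?thesis
    by (simp add: prod.reindex case_prod_beta)
qed

text \<open>Monotonicity on \<open>A\<close> is required because the factors of a pair depend on the
  order of its two indices.\<close>

lemma rename_kernel:
  assumes "bij f" "strict_mono_on A f"
  shows "rename f (pair_kernel A) = pair_kernel (f ` A)"
proof -
  have "rename f (\<Prod>(i, j)\<in>ordered_pairs A. g i j) = (\<Prod>(i, j)\<in>ordered_pairs A. rename f (g i j))" for g
    by (simp add: rename_prod[OF assms(1)] case_prod_beta)
  then show ?thesis
    unfolding pair_kernel_def vander_def prod_pairs_reindex[OF assms(2)]
    by (simp only: rename_mult rename_diff rename_X rename_quad assms(1))
qed

lemma vanish_ord_quad: "vanish_ord p 0 (quad i j)"
  by (simp add: quad_def vanish_ord_add vanish_ord_one vanish_ord_X0 vanish_ord_mult0)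

lemma vanish_ord_vander: "vanish_ord p 0 (vander X S)"
  by (auto simp: vander_def intro!: vanish_ord_prod0 vanish_ord_diff vanish_ord_X0)

lemma vanish_ord_kernel: "vanish_ord p 0 (pair_kernel S)"
  by (auto simp: pair_kernel_def intro!: vanish_ord_mult0 vanish_ord_vander vanish_ord_prod0 vanish_ord_quad)

lemma vanish_ord_Y: "vanish_ord p 0 (1 + X i)"
  by (simp add: vanish_ord_add vanish_ord_one vanish_ord_X0)

lemma vanish_ord_weight:
  assumes "p \<notin> S"
  shows "vanish_ord p 0 (weight a e S)"
  unfolding weight_def
proof (intro vanish_ord_prod0 vanish_ord_mult0 vanish_ord_power0 vanish_ord_Y)
  fix i assume "i \<in> S"
  then show "vanish_ord p 0 (xpow i (e i))"
    using assms vanish_ord_xpow[of p i "e i"] by (auto split: if_splits)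
qed

lemma cong_at_0_quad_left: "cong_at_0 p (quad i p) 1"
proof -
  have "vanish_ord p (1 + 0) (X p * (1 + X i))"
    using vanish_ord_X[of p p] by (intro vanish_ord_mult vanish_ord_Y) simp
  then show ?thesis
    by (simp add: cong_at_0_def vanish_ord_quad vanish_ord_one) (simp add: quad_def algebra_simps)
qed

lemma cong_at_0_quad_right: "cong_at_0 p (quad p j) (1 + X j)"
proof -
  have "vanish_ord p (1 + 0) (X p * X j)"
    using vanish_ord_X[of p p] by (intro vanish_ord_mult vanish_ord_X0) simp
  then show ?thesis
    by (simp add: cong_at_0_def vanish_ord_quad vanish_ord_Y) (simp add: quad_def)
qed

lemma cong_at_0_Y: "cong_at_0 p (1 + X p) 1"
  using vanish_ord_X[of p p] by (simp add: cong_at_0_def vanish_ord_Y vanish_ord_one)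

lemma cong_at_0_xpow:
  assumes "0 \<le> d"
  shows "cong_at_0 p (xpow p d) (if d = 0 then 1 else 0)"
proof (cases "d = 0")
  case True
  then show ?thesis by (simp add: xpow_0 cong_at_0_refl vanish_ord_one)
next
  case False
  have "vanish_ord p d (xpow p d)" using vanish_ord_xpow[of p p d] by simp
  then show ?thesis
    using assms False by (auto simp: cong_at_0_def vanish_ord_mono) (auto simp: vanish_ord_def)
qed

text \<open>On \<open>{1..N}\<close> this is the increasing enumeration of
  \<open>{1..Suc N} - {p}\<close>. Sending \<open>Suc N\<close> to \<open>p\<close> completes it to
  a bijection of the naturals, as \<open>rename\<close> demands.\<close>

definition skip_index :: "nat \<Rightarrow> nat \<Rightarrow> nat \<Rightarrow> nat" where
  "skip_index N p i = (if i = Suc N then p else if p \<le> i \<and> i \<le> N then Suc i else i)"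

lemma bij_skip_index:
  assumes "p \<in> {1..Suc N}"
  shows "bij (skip_index N p)"
proof (rule o_bij)
  let ?g = "\<lambda>j. if j = p then Suc N else if p < j \<and> j \<le> Suc N then j - 1 else j"
  show "?g \<circ> skip_index N p = id" "skip_index N p \<circ> ?g = id"
    using assms by (auto simp: fun_eq_iff skip_index_def)
qed

lemma skip_index_image:
  assumes "p \<in> {1..Suc N}"
  shows "skip_index N p ` {1..N} = {1..Suc N} - {p}"
proof (intro equalityI subsetI)
  fix j assume j: "j \<in> {1..Suc N} - {p}"
  show "j \<in> skip_index N p ` {1..N}"
  proof (cases "j < p")
    case True
    then show ?thesis using j assms by (intro image_eqI[of _ _ j]) (auto simp: skip_index_def)
  next
    case False
    then show ?thesis using j assms by (intro image_eqI[of _ _ "j - 1"]) (auto simp: skip_index_def)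
  qed
qed (use assms in \<open>auto simp: skip_index_def split: if_splits\<close>)

lemma strict_mono_on_skip_index: "strict_mono_on {1..N} (skip_index N p)"
  by (auto simp: strict_mono_on_def skip_index_def)

text \<open>Renumbers the variables left after \<open>p\<close> is removed. Each variable beyond
  \<open>p\<close> carries one extra factor \<open>1 + X j\<close>, which accounts for the outer
  \<open>Suc\<close> in \<open>Suc (a (Suc i))\<close>; the inner one is the index shift.\<close>

lemma weighted_ct_rename_skip_index:
  assumes p: "p \<in> {1..Suc N}"
  defines "S \<equiv> {1..Suc N}"
  shows "weighted_ct N (\<lambda>i. if i < p then a i else Suc (a (Suc i))) (\<lambda>i. if i < p then e i else e (Suc i)) =
    constant_term ((\<Prod>j | j \<in> S \<and> p < j. 1 + X j) * (weight a e (S - {p}) * pair_kernel (S - {p})))"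
proof -
  let ?a = "\<lambda>i. if i < p then a i else Suc (a (Suc i))" and ?e = "\<lambda>i. if i < p then e i else e (Suc i)"
  let ?s = "skip_index N p"
  note bij = bij_skip_index[OF p]
  let ?g = "\<lambda>q. (if p < q then 1 + X q else 1) * ((1 + X q) ^ a q * xpow q (e q))"
  have "rename ?s (weight ?a ?e {1..N}) = (\<Prod>i=1..N. (1 + X (?s i)) ^ ?a i * xpow (?s i) (?e i))"
    by (simp add: weight_def rename_simps bij)
  also have "\<dots> = (\<Prod>i=1..N. ?g (?s i))"
    using p by (intro prod.cong) (auto simp: skip_index_def)
  also have "\<dots> = prod ?g (?s ` {1..N})"
    by (rule prod.reindex_cong[symmetric, OF strict_mono_on_imp_inj_on[OF strict_mono_on_skip_index] refl]) simp
  also have "\<dots> = prod ?g (S - {p})"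
    by (simp only: skip_index_image[OF p] S_def)
  also have "\<dots> = (\<Prod>q\<in>S - {p}. if p < q then 1 + X q else 1) * weight a e (S - {p})"
    by (simp only: prod.distrib weight_def)
  also have "(\<Prod>q\<in>S - {p}. if p < q then 1 + X q else 1) = (\<Prod>j | j \<in> S \<and> p < j. 1 + X j)"
    by (rule prod.mono_neutral_cong_right) (auto simp: S_def)
  finally have "rename ?s (weight ?a ?e {1..N}) = (\<Prod>j | j \<in> S \<and> p < j. 1 + X j) * weight a e (S - {p})" .
  moreover have "rename ?s (pair_kernel {1..N}) = pair_kernel (S - {p})"
    by (simp only: rename_kernel[OF bij strict_mono_on_skip_index] skip_index_image[OF p] S_def)
  ultimately have "rename ?s (weight ?a ?e {1..N} * pair_kernel {1..N}) =
      (\<Prod>j | j \<in> S \<and> p < j. 1 + X j) * (weight a e (S - {p}) * pair_kernel (S - {p}))"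
    by (simp only: rename_mult[OF bij] mult.assoc)
  then have "constant_term (weight ?a ?e {1..N} * pair_kernel {1..N}) =
      constant_term ((\<Prod>j | j \<in> S \<and> p < j. 1 + X j) * (weight a e (S - {p}) * pair_kernel (S - {p})))"
    using constant_term_rename[OF bij, of "weight ?a ?e {1..N} * pair_kernel {1..N}"] by (simp only:)
  then show ?thesis
    by (simp only: weighted_ct_def)
qed

lemma weighted_ct_laplace_term:
  assumes p: "p \<in> {1..Suc N}" and e: "- int N \<le> e p"
  defines "S \<equiv> {1..Suc N}"
  shows "constant_term (weight a e S * (X p ^ N * vander X (S - {p}) * (\<Prod>(i, j)\<in>ordered_pairs S. quad i j))) =
    (if e p = - int N
     then weighted_ct N (\<lambda>i. if i < p then a i else Suc (a (Suc i))) (\<lambda>i. if i < p then e i else e (Suc i)) else 0)"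
proof -
  have S: "finite S" "p \<in> S" using p by (auto simp: S_def)
  let ?L = "\<Prod>i | i \<in> S \<and> i < p. quad i p" and ?R = "\<Prod>j | j \<in> S \<and> p < j. quad p j"
  let ?Y = "\<Prod>j | j \<in> S \<and> p < j. 1 + X j"
  let ?W = "weight a e (S - {p}) * pair_kernel (S - {p})"
  have "weight a e S = ((1 + X p) ^ a p * xpow p (e p)) * weight a e (S - {p})"
    unfolding weight_def by (rule prod.remove[OF S])
  moreover have "xpow p (e p + int N) = xpow p (e p) * X p ^ N"
    by (simp add: xpow_add xpow_of_nat)
  ultimately have "weight a e S * (X p ^ N * vander X (S - {p}) * (\<Prod>(i, j)\<in>ordered_pairs S. quad i j)) =
      ((1 + X p) ^ a p * xpow p (e p + int N) * (?L * ?R)) * ?W"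
    by (simp only: prod_pairs_remove[OF S, of quad] pair_kernel_def ac_simps)
  then have "constant_term (weight a e S * (X p ^ N * vander X (S - {p}) * (\<Prod>(i, j)\<in>ordered_pairs S. quad i j))) =
      constant_term (((1 + X p) ^ a p * xpow p (e p + int N) * (?L * ?R)) * ?W)"
    by (simp only:)
  \<comment> \<open>The exponent \<open>e p + int N\<close> is nonnegative, so no factor has a pole
    at \<open>X p = 0\<close> and each is replaced by its value there: \<open>?L\<close> becomes 1,
    \<open>?R\<close> becomes \<open>?Y\<close>, and the power of \<open>X p\<close> becomes 1 or
    0.\<close>
  also have "constant_term (((1 + X p) ^ a p * xpow p (e p + int N) * (?L * ?R)) * ?W) =
      constant_term ((1 ^ a p * (if e p + int N = 0 then 1 else 0) * ((\<Prod>i | i \<in> S \<and> i < p. 1) * ?Y)) * ?W)"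
  proof (rule constant_term_cong_at_0)
    show "cong_at_0 p (((1 + X p) ^ a p * xpow p (e p + int N) * (?L * ?R)) * ?W)
      ((1 ^ a p * (if e p + int N = 0 then 1 else 0) * ((\<Prod>i | i \<in> S \<and> i < p. 1) * ?Y)) * ?W)"
      using e by (intro cong_at_0_mult cong_at_0_power cong_at_0_prod cong_at_0_quad_left cong_at_0_quad_right
        cong_at_0_Y cong_at_0_xpow cong_at_0_refl vanish_ord_mult0 vanish_ord_weight vanish_ord_kernel) auto
  qed
  also have "\<dots> = (if e p = - int N then constant_term (?Y * ?W) else 0)"
    by (simp add: constant_term_def)
  finally show ?thesis
    unfolding weighted_ct_rename_skip_index[OF p] by (simp only: S_def)
qed

lemma weighted_ct_Suc:
  assumes e: "\<And>i. i \<in> {1..Suc N} \<Longrightarrow> - int N \<le> e i"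
  shows "weighted_ct (Suc N) a e = (\<Sum>p | p \<in> {1..Suc N} \<and> e p = - int N. (- 1) ^ (p - 1) *
    weighted_ct N (\<lambda>i. if i < p then a i else Suc (a (Suc i))) (\<lambda>i. if i < p then e i else e (Suc i)))"
proof -
  let ?S = "{1..Suc N}" and ?Q = "\<Prod>(i, j)\<in>ordered_pairs {1..Suc N}. quad i j"
  have "vander X ?S = (\<Sum>p\<in>?S. (- 1) ^ (p - 1) * X p ^ N * vander X (?S - {p}))"
    by (rule vander_laplace) (simp add: inj_on_def inj_X)
  then have "weight a e ?S * pair_kernel ?S =
      (\<Sum>p\<in>?S. (- 1) ^ (p - 1) * (weight a e ?S * (X p ^ N * vander X (?S - {p}) * ?Q)))"
    unfolding pair_kernel_def by (simp only: sum_distrib_left sum_distrib_right ac_simps)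
  then have "weighted_ct (Suc N) a e = (\<Sum>p\<in>?S. (- 1) ^ (p - 1) *
      constant_term (weight a e ?S * (X p ^ N * vander X (?S - {p}) * ?Q)))"
    by (simp only: weighted_ct_def constant_term_sum constant_term_sign)
  also have "\<dots> = (\<Sum>p\<in>?S. if e p = - int N then (- 1) ^ (p - 1) *
      weighted_ct N (\<lambda>i. if i < p then a i else Suc (a (Suc i))) (\<lambda>i. if i < p then e i else e (Suc i)) else 0)"
    using e weighted_ct_laplace_term[of _ N e a] by (intro sum.cong refl) (simp only: if_distrib[of "(*) _"] mult_zero_right)
  finally show ?thesis
    by (simp only: sum.inter_filter[OF finite_atLeastAtMost])
qed

section \<open>Sums over interlacing rows\<close>

text \<open>An abstraction of \<open>pair_kernel\<close>: multiplying by
  \<open>quad (Suc i) i\<close> makes the \<open>quad\<close> factors symmetric under the swap, so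
  that the factor \<open>X i - X (Suc i)\<close> decides the sign.\<close>

definition antisym_kernel :: "nat \<Rightarrow> laurent_mpoly \<Rightarrow> bool" where
  "antisym_kernel r K \<longleftrightarrow> (\<forall>i. 1 \<le> i \<and> i < r \<longrightarrow>
     rename (transpose i (Suc i)) (quad (Suc i) i * K) = - (quad (Suc i) i * K))"

text \<open>Quantifying over all such \<open>K\<close> lets symmetric factors be absorbed into
  \<open>K\<close>, which gives the closure under multiplication used in the induction on
  \<open>r\<close>.\<close>

definition swap_null :: "nat \<Rightarrow> laurent_mpoly \<Rightarrow> bool" where
  "swap_null r h \<longleftrightarrow> (\<forall>K. antisym_kernel r K \<longrightarrow> constant_term (h * K) = 0)"

lemma swap_null_zero: "swap_null r 0"
  by (simp add: swap_null_def constant_term_def)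

lemma swap_null_diff: "swap_null r g \<Longrightarrow> swap_null r h \<Longrightarrow> swap_null r (g - h)"
  by (simp add: swap_null_def left_diff_distrib constant_term_diff)

lemma antisym_kernel_mult:
  assumes "antisym_kernel r K" "\<And>i. 1 \<le> i \<Longrightarrow> i < r \<Longrightarrow> rename (transpose i (Suc i)) g = g"
  shows "antisym_kernel r (g * K)"
  unfolding antisym_kernel_def
proof (intro allI impI)
  fix i assume i: "1 \<le> i \<and> i < r"
  have "rename (transpose i (Suc i)) (g * (quad (Suc i) i * K)) = g * - (quad (Suc i) i * K)"
    using assms i by (simp only: rename_mult[of _ g] antisym_kernel_def bij_transpose)
  then show "rename (transpose i (Suc i)) (quad (Suc i) i * (g * K)) = - (quad (Suc i) i * (g * K))"
    by (simp only: mult.left_commute mult_minus_right)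
qed

lemma swap_null_mult:
  assumes "swap_null r h" "r \<le> s" "\<And>i. 1 \<le> i \<Longrightarrow> i < r \<Longrightarrow> rename (transpose i (Suc i)) g = g"
  shows "swap_null s (h * g)"
  unfolding swap_null_def
proof (intro allI impI)
  fix K assume "antisym_kernel s K"
  then have "antisym_kernel r K" using assms(2) by (simp add: antisym_kernel_def)
  then have "antisym_kernel r (g * K)" using assms(3) by (rule antisym_kernel_mult)
  then show "constant_term (h * g * K) = 0"
    using assms(1) by (simp add: swap_null_def mult.assoc)
qed

text \<open>The whole product changes sign under the swap, while renaming preserves constant terms;
  an integer equal to its negative is zero.\<close>

lemma swap_null_quad:
  assumes "1 \<le> i" "i < r" "rename (transpose i (Suc i)) h = h"
  shows "swap_null r (h * quad (Suc i) i)"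
  unfolding swap_null_def
proof (intro allI impI)
  fix K assume K: "antisym_kernel r K"
  show "constant_term (h * quad (Suc i) i * K) = 0"
  proof (rule constant_term_eq_0_if_antisym[of "transpose i (Suc i)"])
    have "rename (transpose i (Suc i)) (h * (quad (Suc i) i * K)) = h * - (quad (Suc i) i * K)"
      using K assms by (simp only: rename_mult[of _ h] antisym_kernel_def bij_transpose)
    then show "rename (transpose i (Suc i)) (h * quad (Suc i) i * K) = - (h * quad (Suc i) i * K)"
      by (simp only: mult.assoc mult_minus_right)
  qed simp
qed

lemma quad_kernel_antisym:
  assumes "finite S" "i \<in> S" "Suc i \<in> S"
  shows "rename (transpose i (Suc i)) (quad (Suc i) i * pair_kernel S) = - (quad (Suc i) i * pair_kernel S)"
proof -
  let ?t = "transpose i (Suc i)" and ?D = "ordered_pairs S - {(i, Suc i)}"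
  let ?f = "\<lambda>p q. (X p - X q) * quad p q"
  have "pair_kernel S = (\<Prod>(p, q)\<in>ordered_pairs S. ?f p q)"
    by (simp add: pair_kernel_def vander_def case_prod_beta prod.distrib)
  also have "\<dots> = ?f i (Suc i) * (\<Prod>(p, q)\<in>?D. ?f p q)"
    using assms prod.remove[of "ordered_pairs S" "(i, Suc i)" "\<lambda>(p, q). ?f p q"]
    by (simp add: finite_pairs) (simp add: ordered_pairs_def)
  finally have K: "pair_kernel S = ?f i (Suc i) * (\<Prod>(p, q)\<in>?D. ?f p q)" .
  have "rename ?t (\<Prod>(p, q)\<in>?D. ?f p q) = (\<Prod>(p, q)\<in>?D. ?f (?t p) (?t q))"
    by (simp add: rename_simps rename_quad case_prod_beta)
  \<comment> \<open>The swapped indices are adjacent, so the transposition preserves the order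
    within every pair other than \<open>(i, Suc i)\<close> and permutes \<open>?D\<close>.\<close>
  also have "\<dots> = (\<Prod>(p, q)\<in>?D. ?f p q)"
    by (rule prod.reindex_bij_witness[of _ "map_prod ?t ?t" "map_prod ?t ?t"])
      (use assms in \<open>auto simp: ordered_pairs_def transpose_def split: if_splits\<close>)
  finally have D: "rename ?t (\<Prod>(p, q)\<in>?D. ?f p q) = (\<Prod>(p, q)\<in>?D. ?f p q)" .
  have "rename ?t (quad (Suc i) i * ?f i (Suc i)) = - (quad (Suc i) i * ?f i (Suc i))"
    by (simp add: rename_simps rename_quad algebra_simps)
  then show ?thesis
    unfolding K mult.assoc[symmetric, of "quad (Suc i) i" "?f i (Suc i)"]
    by (simp only: rename_mult[OF bij_transpose, of _ _ _ "\<Prod>(p, q)\<in>?D. ?f p q"] D mult_minus_left)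
qed

section \<open>Interlacing rows and their generating function\<close>

definition interlacing :: "nat \<Rightarrow> (nat \<Rightarrow> nat) \<Rightarrow> (nat \<Rightarrow> nat) set" where
  "interlacing r b = {l. (\<forall>i. i \<notin> {1..r} \<longrightarrow> l i = 0) \<and> (\<forall>i\<in>{1..r}. b i \<le> l i \<and> l i \<le> b (Suc i)) \<and>
     (\<forall>i. 1 \<le> i \<and> i < r \<longrightarrow> l i < l (Suc i))}"

lemma finite_interlacing: "finite (interlacing r b)"
proof -
  let ?M = "Max (b ` {1..Suc r})"
  let ?F = "{l. \<forall>i. (i \<in> {1..r} \<longrightarrow> l i \<in> {0..?M}) \<and> (i \<notin> {1..r} \<longrightarrow> l i = 0)}"
  have "finite ?F"
    by (rule finite_set_of_finite_funs) simp_all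
  moreover have "interlacing r b \<subseteq> ?F"
  proof
    fix l assume l: "l \<in> interlacing r b"
    have "l i \<le> ?M" if "i \<in> {1..r}" for i
    proof -
      have "l i \<le> b (Suc i)" using l that by (simp add: interlacing_def)
      also have "b (Suc i) \<le> ?M" using that by (intro Max_ge) auto
      finally show ?thesis .
    qed
    then show "l \<in> ?F" using l by (simp add: interlacing_def)
  qed
  ultimately show ?thesis by (rule finite_subset[rotated])
qed

definition row_sum :: "nat \<Rightarrow> (nat \<Rightarrow> nat) \<Rightarrow> laurent_mpoly" where
  "row_sum r b = (\<Sum>l\<in>interlacing r b. \<Prod>i=1..r. (1 + X i) ^ l i)"

lemma row_sum_0: "row_sum 0 b = 1"
proof -
  have "interlacing 0 b = {\<lambda>_. 0}" by (auto simp: interlacing_def)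
  then show ?thesis by (simp add: row_sum_def)
qed

lemma row_sum_1: "row_sum (Suc 0) b = (\<Sum>v=b 1..b 2. (1 + X 1) ^ v)"
  unfolding row_sum_def
proof (rule sum.reindex_bij_witness[of _ "\<lambda>v i. if i = 1 then v else 0" "\<lambda>l. l 1"])
  fix l assume "l \<in> interlacing (Suc 0) b"
  then show "(\<lambda>i. if i = 1 then l 1 else 0) = l" "l 1 \<in> {b 1..b 2}"
    by (auto simp: interlacing_def fun_eq_iff numeral_2_eq_2)
qed (auto simp: interlacing_def numeral_2_eq_2)

text \<open>The right side appends an arbitrary last entry \<open>v\<close> to a row of length
  \<open>Suc r\<close>. Strictness can only fail when \<open>v\<close> equals the previous entry,
  and the bounds then force both to be \<open>b (Suc (Suc r))\<close>. The first \<open>r\<close>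
  entries of such a row are an arbitrary interlacing row, which yields the correction term on the
  left.\<close>

lemma row_sum_Suc_Suc:
  assumes b: "strict_mono_on {1..Suc (Suc (Suc r))} b"
  shows "row_sum (Suc (Suc r)) b + row_sum r b * ((1 + X (Suc r)) * (1 + X (Suc (Suc r)))) ^ b (Suc (Suc r)) =
    row_sum (Suc r) b * (\<Sum>v=b (Suc (Suc r))..b (Suc (Suc (Suc r))). (1 + X (Suc (Suc r))) ^ v)"
proof -
  let ?s = "Suc (Suc r)"
  let ?I = "interlacing (Suc r) b \<times> {b ?s..b (Suc ?s)}"
  let ?g = "\<lambda>(l, v). (\<Prod>i=1..Suc r. (1 + X i) ^ l i) * (1 + X ?s) ^ v"
  let ?bad = "{(l, v) \<in> ?I. l (Suc r) = v}"
  have bs: "b (Suc r) < b ?s" "b ?s \<le> b (Suc ?s)"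
    using b by (auto simp: strict_mono_on_def less_imp_le)
  have "row_sum (Suc r) b * (\<Sum>v=b ?s..b (Suc ?s). (1 + X ?s) ^ v) = sum ?g ?I"
    unfolding row_sum_def by (simp only: sum_product sum.cartesian_product)
  also have "\<dots> = sum ?g ?bad + sum ?g (?I - ?bad)"
    by (subst sum.subset_diff[of ?bad]) (auto simp: finite_interlacing add.commute)
  also have "sum ?g (?I - ?bad) = row_sum ?s b"
    unfolding row_sum_def
  proof (rule sum.reindex_bij_witness[of _ "\<lambda>l. (l(?s := 0), l ?s)" "\<lambda>(l, v). l(?s := v)"])
    fix lv assume "lv \<in> ?I - ?bad"
    moreover obtain l v where lv: "lv = (l, v)" by (cases lv)
    ultimately have l: "l \<in> interlacing (Suc r) b" and v: "v \<in> {b ?s..b (Suc ?s)}" "l (Suc r) \<noteq> v"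
      by auto
    have zero: "l ?s = 0" using l by (simp add: interlacing_def)
    have "l (Suc r) \<le> b ?s" using l by (auto simp: interlacing_def)
    then have less: "l (Suc r) < v" using v by simp
    show "((case lv of (l, v) \<Rightarrow> l(?s := v))(?s := 0), (case lv of (l, v) \<Rightarrow> l(?s := v)) ?s) = lv"
      using zero by (auto simp: lv fun_eq_iff)
    show "(case lv of (l, v) \<Rightarrow> l(?s := v)) \<in> interlacing ?s b"
      using l v less by (auto simp: lv interlacing_def less_Suc_eq)
    show "(\<Prod>i=1..?s. (1 + X i) ^ (case lv of (l, v) \<Rightarrow> l(?s := v)) i) = ?g lv"
      by (simp add: lv)
  next
    fix l assume l: "l \<in> interlacing ?s b"
    then show "(case (l(?s := 0), l ?s) of (l, v) \<Rightarrow> l(?s := v)) = l" by auto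
    have "l (Suc r) < l ?s" using l by (simp add: interlacing_def)
    then show "(l(?s := 0), l ?s) \<in> ?I - ?bad"
      using l by (auto simp: interlacing_def)
  qed
  also have "sum ?g ?bad = (\<Sum>l\<in>interlacing r b. (\<Prod>i=1..r. (1 + X i) ^ l i) * ((1 + X (Suc r)) * (1 + X ?s)) ^ b ?s)"
  proof (rule sum.reindex_bij_witness[of _ "\<lambda>l. (l(Suc r := b ?s), b ?s)" "\<lambda>(l, v). l(Suc r := 0)"])
    fix lv assume "lv \<in> ?bad"
    moreover obtain l v where "lv = (l, v)" by (cases lv)
    ultimately have lv: "lv = (l, l (Suc r))" and l: "l \<in> interlacing (Suc r) b"
      and v: "b ?s \<le> l (Suc r)" by auto
    have "l (Suc r) \<le> b ?s" using l by (auto simp: interlacing_def)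
    then have eq: "l (Suc r) = b ?s" using v by simp
    show "((case lv of (l, v) \<Rightarrow> l(Suc r := 0))(Suc r := b ?s), b ?s) = lv"
      using eq by (auto simp: lv fun_eq_iff)
    show "(case lv of (l, v) \<Rightarrow> l(Suc r := 0)) \<in> interlacing r b"
      using l by (auto simp: lv interlacing_def)
    show "(\<Prod>i=1..r. (1 + X i) ^ (case lv of (l, v) \<Rightarrow> l(Suc r := 0)) i) * ((1 + X (Suc r)) * (1 + X ?s)) ^ b ?s = ?g lv"
      by (simp add: lv eq power_mult_distrib mult.assoc)
  next
    fix l assume l: "l \<in> interlacing r b"
    then have "l (Suc r) = 0" by (simp add: interlacing_def)
    then show "(case (l(Suc r := b ?s), b ?s) of (l, v) \<Rightarrow> l(Suc r := 0)) = l" by auto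
    have "l r \<le> b (Suc r)" if "1 \<le> r" using l that by (auto simp: interlacing_def)
    then have "l r < b ?s" if "1 \<le> r" using bs that by fastforce
    then show "(l(Suc r := b ?s), b ?s) \<in> ?bad"
      using l bs by (auto simp: interlacing_def less_Suc_eq le_Suc_eq)
  qed
  finally show ?thesis
    by (simp only: row_sum_def sum_distrib_right add.commute)
qed

lemma geometric_sum_interval:
  fixes x :: "'a :: comm_ring_1"
  assumes "u \<le> w"
  shows "x * (\<Sum>v=u..w. (1 + x) ^ v) = (1 + x) ^ Suc w - (1 + x) ^ u"
  using assms
proof (induction w rule: dec_induct)
  case (step w)
  then show ?case by (simp add: distrib_left) (simp add: algebra_simps)
qed (simp add: algebra_simps)

text \<open>By \<open>geometric_sum_interval\<close> the i-th geometric sum has a lower endpoint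
  \<open>b i\<close> and an upper endpoint \<open>Suc (b (Suc i))\<close>. Of the expanded product
  of endpoint differences only the terms with lower endpoints before \<open>p\<close> and upper ones
  from \<open>p\<close> on are kept; this is the shape that \<open>weighted_ct_Suc\<close>
  produces.\<close>

definition alt_sum :: "nat \<Rightarrow> (nat \<Rightarrow> nat) \<Rightarrow> laurent_mpoly" where
  "alt_sum r b = (\<Sum>p=1..Suc r. (- 1) ^ (p - 1) * (\<Prod>i=1..r. (1 + X i) ^ (if i < p then b i else Suc (b (Suc i)))))"

text \<open>All summands but the last use the upper endpoint at index \<open>Suc r\<close>; the
  last, \<open>p = Suc (Suc r)\<close>, uses lower endpoints only.\<close>

lemma alt_sum_Suc:
  "alt_sum (Suc r) b = alt_sum r b * (1 + X (Suc r)) ^ Suc (b (Suc (Suc r))) +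
    (- 1) ^ Suc r * (\<Prod>i=1..Suc r. (1 + X i) ^ b i)"
proof -
  let ?f = "\<lambda>r p. (- 1) ^ (p - 1) * (\<Prod>i=1..r. (1 + X i) ^ (if i < p then b i else Suc (b (Suc i))))"
  have "1 \<le> Suc (Suc r)" by simp
  from sum.nat_ivl_Suc'[OF this, of "?f (Suc r)"]
  have "alt_sum (Suc r) b = (\<Sum>p=1..Suc r. ?f (Suc r) p) + ?f (Suc r) (Suc (Suc r))"
    by (simp only: alt_sum_def add.commute)
  also have "?f (Suc r) (Suc (Suc r)) = (- 1) ^ Suc r * (\<Prod>i=1..Suc r. (1 + X i) ^ b i)"
    by (intro arg_cong2[of _ _ _ _ "(*)"] prod.cong) auto
  also have "(\<Sum>p=1..Suc r. ?f (Suc r) p) = (\<Sum>p=1..Suc r. ?f r p * (1 + X (Suc r)) ^ Suc (b (Suc (Suc r))))"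
    by (intro sum.cong) (auto simp: prod.nat_ivl_Suc' mult.commute mult.left_commute)
  finally show ?thesis
    by (simp only: alt_sum_def sum_distrib_right)
qed

lemma alt_sum_0: "alt_sum 0 b = 1"
  by (simp add: alt_sum_def)

lemma rename_alt_sum:
  assumes "r < i"
  shows "rename (transpose i (Suc i)) (alt_sum r b) = alt_sum r b"
proof -
  have "transpose i (Suc i) j = j" if "j \<in> {1..r}" for j
    using that assms by (simp add: transpose_def)
  then show ?thesis
    unfolding alt_sum_def
    by (auto simp: rename_simps intro!: sum.cong prod.cong)
qed

text \<open>The algebra of the induction step below. \<open>S1\<close>, \<open>S0\<close> stand for
  the row sums times the product of the variables and \<open>P1\<close>, \<open>P0\<close> for the
  alternating sums, at \<open>Suc r\<close> and \<open>r\<close>. With \<open>x\<close>,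
  \<open>z\<close> the last two variables, \<open>1 + x + z * x\<close> is \<open>quad\<close> of
  them in reversed order.\<close>

lemma row_step_identity:
  fixes S1 S0 P1 P0 Z R L U V x z :: "'a :: comm_ring_1"
  assumes "P1 = P0 * ((1 + x) * U) + Z"
  shows "S1 * (R - V) - S0 * (U * V * (x * z)) - (P1 * R + - (Z * V)) =
    (S1 - P1) * (R - V) - (S0 - P0) * (U * V * (x * z)) - P0 * (U * V) * (1 + x + z * x)"
  unfolding assms by (simp add: algebra_simps)

text \<open>The product of the \<open>X i\<close> clears the denominators of the geometric sums. The
  recursion for \<open>row_sum\<close> reaches back two lengths, hence the two-step induction; for
  \<open>r = 0\<close> and \<open>r = 1\<close> the difference is exactly zero.\<close>

lemma swap_null_row_sum:
  assumes "strict_mono_on {1..Suc r} b"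
  shows "swap_null r ((\<Prod>i=1..r. X i) * row_sum r b - alt_sum r b)"
  using assms
proof (induction r rule: induct_nat_012)
  case 0
  show ?case by (simp add: row_sum_0 alt_sum_0 swap_null_zero)
next
  case 1
  then have "b 1 \<le> b 2" by (auto simp: strict_mono_on_def less_imp_le)
  then show ?case
    using geometric_sum_interval[of "b 1" "b 2" "X 1"]
    by (simp add: row_sum_1 alt_sum_0 alt_sum_Suc swap_null_zero numeral_2_eq_2)
next
  case (ge2 r)
  let ?s = "Suc (Suc r)"
  let ?S = "\<lambda>r. (\<Prod>i=1..r. X i) * row_sum r b" and ?P = "\<lambda>r. alt_sum r b"
  let ?U = "(1 + X (Suc r)) ^ b ?s" and ?V = "(1 + X ?s) ^ b ?s" and ?R = "(1 + X ?s) ^ Suc (b (Suc ?s))"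
  let ?Z = "(- 1) ^ Suc r * (\<Prod>i=1..Suc r. (1 + X i) ^ b i)"
  have mono: "strict_mono_on {1..Suc r} b" "strict_mono_on {1..?s} b"
    using ge2.prems by (auto simp: strict_mono_on_def)
  have "b ?s \<le> b (Suc ?s)"
    using ge2.prems by (auto simp: strict_mono_on_def less_imp_le)
  note geom = geometric_sum_interval[OF this, of "X ?s"]
  have "?S ?s = (\<Prod>i=1..Suc r. X i) * X ?s * (row_sum (Suc r) b * (\<Sum>v=b ?s..b (Suc ?s). (1 + X ?s) ^ v)
      - row_sum r b * ((1 + X (Suc r)) * (1 + X ?s)) ^ b ?s)"
    unfolding row_sum_Suc_Suc[OF ge2.prems, symmetric] by (simp add: prod.nat_ivl_Suc' mult.commute)
  also have "\<dots> = ?S (Suc r) * (X ?s * (\<Sum>v=b ?s..b (Suc ?s). (1 + X ?s) ^ v)) -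
      ?S r * (?U * ?V * (X (Suc r) * X ?s))"
    by (simp add: prod.nat_ivl_Suc' power_mult_distrib right_diff_distrib)
  finally have S: "?S ?s = ?S (Suc r) * (?R - ?V) - ?S r * (?U * ?V * (X (Suc r) * X ?s))"
    unfolding geom .
  have P1: "?P (Suc r) = ?P r * ((1 + X (Suc r)) * ?U) + ?Z"
    by (simp only: alt_sum_Suc power_Suc)
  have P2: "?P ?s = ?P (Suc r) * ?R + - (?Z * ?V)"
  proof -
    have "(\<Prod>i=1..?s. (1 + X i) ^ b i) = ?V * (\<Prod>i=1..Suc r. (1 + X i) ^ b i)"
      by (rule prod.nat_ivl_Suc') simp
    then show ?thesis
      unfolding alt_sum_Suc[of "Suc r"] power_Suc[of _ "Suc r"]
      by (simp only: mult_minus_left mult_1 mult.commute mult.left_commute)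
  qed
  have eq: "?S ?s - ?P ?s = (?S (Suc r) - ?P (Suc r)) * (?R - ?V) -
      (?S r - ?P r) * (?U * ?V * (X (Suc r) * X ?s)) - ?P r * (?U * ?V) * quad ?s (Suc r)"
    unfolding S P2 quad_def by (rule row_step_identity[OF P1])
  show ?case
    unfolding eq
  \<comment> \<open>The first two terms are induction hypotheses times factors in later variables
    only. In the third, the cofactor of \<open>quad\<close> is symmetric in the last two variables
    because \<open>?U\<close> and \<open>?V\<close> have the same exponent.\<close>
  proof (intro swap_null_diff)
    show "swap_null ?s ((?S (Suc r) - ?P (Suc r)) * (?R - ?V))"
      by (rule swap_null_mult[OF ge2.IH(2)[OF mono(2)]]) (auto simp: rename_simps transpose_def)
    show "swap_null ?s ((?S r - ?P r) * (?U * ?V * (X (Suc r) * X ?s)))"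
      by (rule swap_null_mult[OF ge2.IH(1)[OF mono(1)]]) (auto simp: rename_simps transpose_def)
    show "swap_null ?s (?P r * (?U * ?V) * quad ?s (Suc r))"
      by (rule swap_null_quad) (simp_all add: rename_mult rename_alt_sum rename_simps mult.commute)
  qed
qed

text \<open>The common exponent \<open>d\<close> makes the monomial part symmetric in the first
  \<open>r\<close> variables, so weight and kernel together form an \<open>antisym_kernel\<close>.
  The product of the \<open>X i\<close> on the row side raises these exponents by one.\<close>

lemma alt_sum_ct_eq_row_sum_ct:
  assumes b: "strict_mono_on {1..Suc r} b" and r: "r \<le> N" and e: "\<And>i. i \<in> {1..r} \<Longrightarrow> e i = d"
  shows "(\<Sum>p=1..Suc r. (- 1) ^ (p - 1) *
      weighted_ct N (\<lambda>i. if i \<le> r then if i < p then b i else Suc (b (Suc i)) else c i) e) =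
    (\<Sum>l\<in>interlacing r b. weighted_ct N (\<lambda>i. if i \<le> r then l i else c i) (\<lambda>i. if i \<le> r then e i + 1 else e i))"
proof -
  let ?K = "(\<Prod>i=1..r. xpow i d) * weight c e {Suc r..N} * pair_kernel {1..N}"
  have split: "{1..N} = {1..r} \<union> {Suc r..N}" "{1..r} \<inter> {Suc r..N} = {}"
    using r by auto
  have weight: "weight (\<lambda>i. if i \<le> r then a i else c i) (\<lambda>i. if i \<le> r then e' i else e i) {1..N} =
      (\<Prod>i=1..r. (1 + X i) ^ a i) * (\<Prod>i=1..r. xpow i (e' i)) * weight c e {Suc r..N}" for a e'
    unfolding weight_def split(1)
    by (subst prod.union_disjoint) (auto simp: prod.distrib)
  have alt: "weighted_ct N (\<lambda>i. if i \<le> r then a i else c i) e = constant_term ((\<Prod>i=1..r. (1 + X i) ^ a i) * ?K)" for a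
  proof -
    \<comment> \<open>The trivial conditional in the exponent matches the form of
      \<open>weight\<close> with \<open>e' = e\<close>.\<close>
    have "weighted_ct N (\<lambda>i. if i \<le> r then a i else c i) (\<lambda>i. if i \<le> r then e i else e i) =
      constant_term ((\<Prod>i=1..r. (1 + X i) ^ a i) * ((\<Prod>i=1..r. xpow i (e i)) * weight c e {Suc r..N} * pair_kernel {1..N}))"
      unfolding weighted_ct_def weight by (simp only: mult.assoc)
    also have "(\<Prod>i=1..r. xpow i (e i)) = (\<Prod>i=1..r. xpow i d)"
      using e by simp
    finally show ?thesis by simp
  qed
  have row: "weighted_ct N (\<lambda>i. if i \<le> r then a i else c i) (\<lambda>i. if i \<le> r then e i + 1 else e i) =
      constant_term ((\<Prod>i=1..r. X i) * (\<Prod>i=1..r. (1 + X i) ^ a i) * ?K)" for a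
  proof -
    have "(\<Prod>i=1..r. xpow i (e i + 1)) = (\<Prod>i=1..r. X i) * (\<Prod>i=1..r. xpow i d)"
      using e by (simp add: xpow_add X_def prod.distrib mult.commute)
    then show ?thesis
      unfolding weighted_ct_def weight by (simp only: ac_simps)
  qed
  have "antisym_kernel r ?K"
  proof (rule antisym_kernel_mult)
    show "antisym_kernel r (pair_kernel {1..N})"
      unfolding antisym_kernel_def using r by (auto intro!: quad_kernel_antisym)
  next
    fix i assume i: "1 \<le> i" "i < r"
    let ?t = "transpose i (Suc i)"
    have "(\<Prod>j=1..r. xpow (?t j) d) = (\<Prod>j=1..r. xpow j d)"
      by (rule prod.reindex_bij_witness[of _ ?t ?t]) (use i in \<open>auto simp: transpose_def\<close>)
    moreover have "rename ?t (weight c e {Suc r..N}) = weight c e {Suc r..N}"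
      using i by (auto simp: weight_def rename_simps transpose_def intro!: prod.cong)
    ultimately show "rename ?t ((\<Prod>i=1..r. xpow i d) * weight c e {Suc r..N}) =
        (\<Prod>i=1..r. xpow i d) * weight c e {Suc r..N}"
      by (simp add: rename_mult rename_prod rename_xpow)
  qed
  then have "constant_term (((\<Prod>i=1..r. X i) * row_sum r b - alt_sum r b) * ?K) = 0"
    using swap_null_row_sum[OF b] by (simp only: swap_null_def)
  then have "constant_term (alt_sum r b * ?K) = constant_term ((\<Prod>i=1..r. X i) * row_sum r b * ?K)"
    by (simp add: left_diff_distrib constant_term_diff)
  then show ?thesis
    by (simp only: alt row alt_sum_def row_sum_def sum_distrib_left sum_distrib_right constant_term_sum
        mult.assoc constant_term_sign)
qed

section \<open>Gog trapezoids\<close>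

lemma weighted_ct_cong: "(\<And>i. i \<in> {1..N} \<Longrightarrow> a i = a' i \<and> e i = e' i) \<Longrightarrow> weighted_ct N a e = weighted_ct N a' e'"
  by (simp add: weighted_ct_def weight_def)

definition gog_bottom :: "nat \<Rightarrow> nat \<Rightarrow> nat \<Rightarrow> (nat \<Rightarrow> nat) \<Rightarrow> (nat \<Rightarrow> nat \<Rightarrow> nat) set" where
  "gog_bottom m n k b = {M \<in> gog_trapezoids m n k. \<forall>j\<in>{1..k}. M n j = b j}"

text \<open>The padding value has two roles: it is the exponent of \<open>1 + X i\<close> for
  \<open>i > k\<close>, and it bounds the k-th entry of the row above the bottom row.\<close>

definition bottom_ext :: "nat \<Rightarrow> nat \<Rightarrow> (nat \<Rightarrow> nat) \<Rightarrow> nat \<Rightarrow> nat" where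
  "bottom_ext m k b i = (if i \<le> k then b i else Suc (m + k))"

definition bottom_exp :: "nat \<Rightarrow> nat \<Rightarrow> nat \<Rightarrow> int" where
  "bottom_exp n k i = (if i \<le> k then 1 - int n else int i - int n - int k)"

definition gog_row :: "nat \<Rightarrow> nat \<Rightarrow> (nat \<Rightarrow> nat) \<Rightarrow> bool" where
  "gog_row m k b \<longleftrightarrow> (\<forall>i\<in>{1..k}. 0 < b i) \<and> strict_mono_on {1..k} b \<and> (1 \<le> k \<longrightarrow> b k \<le> m + k)"

lemma strict_mono_on_if_Suc:
  fixes f :: "nat \<Rightarrow> nat"
  assumes "\<And>i. 1 \<le> i \<Longrightarrow> i < r \<Longrightarrow> f i < f (Suc i)"
  shows "strict_mono_on {1..r} f"
proof (rule strict_mono_onI)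
  fix i j assume "i \<in> {1..r}" "j \<in> {1..r}" "i < j"
  then have "i < j" "1 \<le> i" "j \<le> r" by auto
  then show "f i < f j"
  proof (induction j)
    case (Suc j)
    show ?case
    proof (cases "i = j")
      case False
      then have "f i < f j" using Suc by simp
      also have "f j < f (Suc j)" using assms Suc.prems by simp
      finally show ?thesis .
    qed (use assms Suc.prems in simp)
  qed simp
qed

lemma gog_row_le:
  assumes "gog_row m k b" "j \<in> {1..k}"
  shows "b j \<le> m + j"
proof -
  have "1 \<le> j" "j \<le> k" using assms(2) by auto
  from this(2,1) show ?thesis
  proof (induction rule: inc_induct)
    case base
    then show ?case using assms(1) by (simp add: gog_row_def)
  next
    case (step j)
    then have "b j < b (Suc j)" using assms(1) by (auto simp: gog_row_def strict_mono_on_def)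
    then show ?case using step by simp
  qed
qed

lemma strict_mono_on_bottom_ext:
  assumes "gog_row m k b"
  shows "strict_mono_on {1..Suc k} (bottom_ext m k b)"
proof (rule strict_mono_onI)
  fix i j assume "i \<in> {1..Suc k}" "j \<in> {1..Suc k}" "i < j"
  then show "bottom_ext m k b i < bottom_ext m k b j"
    using assms gog_row_le[OF assms, of i]
    by (auto simp: bottom_ext_def gog_row_def strict_mono_on_def)
qed

text \<open>Makes the induction hypothesis applicable to the row above. Its last entry is bounded by
  the padding value if \<open>k \<le> N\<close>, and by \<open>b k \<le> m + k\<close> if
  \<open>k = Suc N\<close>.\<close>

lemma gog_row_interlacing:
  assumes "gog_row m k b" "k \<le> Suc N" "l \<in> interlacing (min k N) (bottom_ext m k b)"
  shows "gog_row (Suc m) (min k N) l"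
  unfolding gog_row_def
proof (intro conjI ballI impI)
  let ?r = "min k N"
  fix i assume i: "i \<in> {1..?r}"
  then have "bottom_ext m k b i \<le> l i" using assms(3) by (simp add: interlacing_def)
  moreover have "0 < b i" using i assms(1) by (simp add: gog_row_def)
  ultimately show "0 < l i" using i by (simp add: bottom_ext_def)
next
  show "strict_mono_on {1..min k N} l"
    using assms(3) by (intro strict_mono_on_if_Suc) (simp add: interlacing_def)
next
  let ?r = "min k N"
  assume r: "1 \<le> ?r"
  then have "l ?r \<le> bottom_ext m k b (Suc ?r)" using assms(3) by (simp add: interlacing_def)
  also have "\<dots> \<le> Suc m + ?r"
  proof (cases "k \<le> N")
    case False
    then have "k = Suc N" using assms(2) by simp
    then show ?thesis using assms(1) by (simp add: bottom_ext_def gog_row_def)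
  qed (simp add: bottom_ext_def)
  finally show "l ?r \<le> Suc m + ?r" .
qed

section \<open>Deleting and restoring the bottom row\<close>

lemma gog_trapezoidsD:
  assumes "M \<in> gog_trapezoids m n k"
  shows "\<not> (1 \<le> i \<and> i \<le> n \<and> 1 \<le> j \<and> j \<le> min i k) \<Longrightarrow> M i j = 0"
    and "1 \<le> i \<Longrightarrow> i \<le> n \<Longrightarrow> 1 \<le> j \<Longrightarrow> j \<le> i \<Longrightarrow> j \<le> k \<Longrightarrow> 0 < M i j \<and> M i j \<le> m + n - i + j"
    and "1 \<le> i \<Longrightarrow> i < n \<Longrightarrow> 1 \<le> j \<Longrightarrow> j \<le> i \<Longrightarrow> j \<le> k \<Longrightarrow> M (Suc i) j \<le> M i j"
    and "1 \<le> i \<Longrightarrow> i < n \<Longrightarrow> 1 \<le> j \<Longrightarrow> j \<le> i \<Longrightarrow> j < k \<Longrightarrow> M i j \<le> M (Suc i) (Suc j)"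
    and "1 \<le> i \<Longrightarrow> i \<le> n \<Longrightarrow> 1 \<le> j \<Longrightarrow> j < i \<Longrightarrow> j < k \<Longrightarrow> M i j < M i (Suc j)"
  using assms by (auto simp: gog_trapezoids_def)

lemma gog_trapezoidsI:
  assumes "\<And>i j. \<not> (1 \<le> i \<and> i \<le> n \<and> 1 \<le> j \<and> j \<le> i \<and> j \<le> k) \<Longrightarrow> M i j = 0"
    and "\<And>i j. 1 \<le> i \<Longrightarrow> i \<le> n \<Longrightarrow> 1 \<le> j \<Longrightarrow> j \<le> i \<Longrightarrow> j \<le> k \<Longrightarrow> 0 < M i j \<and> M i j \<le> m + n - i + j"
    and "\<And>i j. 1 \<le> i \<Longrightarrow> i < n \<Longrightarrow> 1 \<le> j \<Longrightarrow> j \<le> i \<Longrightarrow> j \<le> k \<Longrightarrow> M (Suc i) j \<le> M i j"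
    and "\<And>i j. 1 \<le> i \<Longrightarrow> i < n \<Longrightarrow> 1 \<le> j \<Longrightarrow> j \<le> i \<Longrightarrow> j < k \<Longrightarrow> M i j \<le> M (Suc i) (Suc j)"
    and "\<And>i j. 1 \<le> i \<Longrightarrow> i \<le> n \<Longrightarrow> 1 \<le> j \<Longrightarrow> j < i \<Longrightarrow> j < k \<Longrightarrow> M i j < M i (Suc j)"
  shows "M \<in> gog_trapezoids m n k"
  using assms unfolding gog_trapezoids_def by simp

text \<open>One row fewer and \<open>Suc m\<close> in place of \<open>m\<close> leave
  \<open>m + n\<close>, and with it every entry bound, unchanged. Row \<open>N\<close> has at most
  \<open>N\<close> entries, hence \<open>min k N\<close>.\<close>

lemma gog_remove_bottom:
  assumes "k \<le> Suc N" and M: "M \<in> gog_bottom m (Suc N) k b"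
  defines "M' \<equiv> M(Suc N := (\<lambda>_. 0))"
  shows "M' N \<in> interlacing (min k N) (bottom_ext m k b)"
    and "M' \<in> gog_trapezoids (Suc m) N (min k N)"
proof -
  have G: "M \<in> gog_trapezoids m (Suc N) k" and bottom: "\<And>j. j \<in> {1..k} \<Longrightarrow> M (Suc N) j = b j"
    using M by (auto simp: gog_bottom_def)
  note D = gog_trapezoidsD[OF G]
  show "M' N \<in> interlacing (min k N) (bottom_ext m k b)"
    unfolding interlacing_def
  proof (intro CollectI conjI allI ballI impI)
    fix i assume "i \<notin> {1..min k N}"
    then show "M' N i = 0" using D(1)[of N i] by (auto simp: M'_def)
  next
    fix i assume i: "i \<in> {1..min k N}"
    then show "bottom_ext m k b i \<le> M' N i"
      using D(3)[of N i] bottom[of i] by (simp add: M'_def bottom_ext_def)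
    \<comment> \<open>For \<open>i < k\<close> this is the SE-diagonal condition; for
      \<open>i = k\<close> it is the entry bound of row \<open>N\<close>.\<close>
    show "M' N i \<le> bottom_ext m k b (Suc i)"
      using i D(4)[of N i] D(2)[of N i] bottom[of "Suc i"] by (simp add: M'_def bottom_ext_def Suc_le_eq)
  next
    fix i assume "1 \<le> i \<and> i < min k N"
    then show "M' N i < M' N (Suc i)" using D(5)[of N i] by (simp add: M'_def)
  qed
  show "M' \<in> gog_trapezoids (Suc m) N (min k N)"
  proof (rule gog_trapezoidsI)
    fix i j assume "\<not> (1 \<le> i \<and> i \<le> N \<and> 1 \<le> j \<and> j \<le> i \<and> j \<le> min k N)"
    then show "M' i j = 0" using D(1)[of i j] by (auto simp: M'_def)
  next
    fix i j assume "1 \<le> i" "i \<le> N" "1 \<le> j" "j \<le> i" "j \<le> min k N"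
    then show "0 < M' i j \<and> M' i j \<le> Suc m + N - i + j" using D(2)[of i j] by (simp add: M'_def)
  next
    fix i j assume "1 \<le> i" "i < N" "1 \<le> j" "j \<le> i" "j \<le> min k N"
    then show "M' (Suc i) j \<le> M' i j" using D(3)[of i j] by (simp add: M'_def)
  next
    fix i j assume "1 \<le> i" "i < N" "1 \<le> j" "j \<le> i" "j < min k N"
    then show "M' i j \<le> M' (Suc i) (Suc j)" using D(4)[of i j] by (simp add: M'_def)
  next
    fix i j assume "1 \<le> i" "i \<le> N" "1 \<le> j" "j < i" "j < min k N"
    then show "M' i j < M' i (Suc j)" using D(5)[of i j] by (simp add: M'_def)
  qed
qed

lemma gog_add_bottom:
  assumes "k \<le> Suc N" and b: "gog_row m k b"
    and l: "l \<in> interlacing (min k N) (bottom_ext m k b)" and M': "M' \<in> gog_bottom (Suc m) N (min k N) l"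
  shows "M'(Suc N := (\<lambda>j. if j \<in> {1..k} then b j else 0)) \<in> gog_bottom m (Suc N) k b" (is "?M \<in> _")
proof -
  have G: "M' \<in> gog_trapezoids (Suc m) N (min k N)" and row: "\<And>j. j \<in> {1..min k N} \<Longrightarrow> M' N j = l j"
    using M' by (auto simp: gog_bottom_def)
  note D = gog_trapezoidsD[OF G]
  \<comment> \<open>For \<open>j = k\<close> the upper bound in \<open>interlacing\<close> is the
    padding value instead of an entry of \<open>b\<close>, hence the guard
    \<open>j < k\<close>.\<close>
  have lower: "b j \<le> M' N j" and upper: "j < k \<Longrightarrow> M' N j \<le> b (Suc j)" if "j \<in> {1..min k N}" for j
    using that l row[OF that] by (auto simp: interlacing_def bottom_ext_def Ball_def split: if_splits)
  have "?M \<in> gog_trapezoids m (Suc N) k"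
  proof (rule gog_trapezoidsI)
    fix i j assume "\<not> (1 \<le> i \<and> i \<le> Suc N \<and> 1 \<le> j \<and> j \<le> i \<and> j \<le> k)"
    then show "?M i j = 0" using D(1)[of i j] assms(1) by auto
  next
    fix i j assume ij: "1 \<le> i" "i \<le> Suc N" "1 \<le> j" "j \<le> i" "j \<le> k"
    show "0 < ?M i j \<and> ?M i j \<le> m + Suc N - i + j"
    proof (cases "i = Suc N")
      case True
      then show ?thesis using ij b gog_row_le[OF b, of j] by (simp add: gog_row_def)
    next
      case False
      then show ?thesis using ij D(2)[of i j] by simp
    qed
  next
    fix i j assume ij: "1 \<le> i" "i < Suc N" "1 \<le> j" "j \<le> i" "j \<le> k"
    then show "?M (Suc i) j \<le> ?M i j"
      using D(3)[of i j] lower[of j] by (cases "i = N") simp_all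
  next
    fix i j assume ij: "1 \<le> i" "i < Suc N" "1 \<le> j" "j \<le> i" "j < k"
    then show "?M i j \<le> ?M (Suc i) (Suc j)"
      using D(4)[of i j] upper[of j] by (cases "i = N") simp_all
  next
    fix i j assume ij: "1 \<le> i" "i \<le> Suc N" "1 \<le> j" "j < i" "j < k"
    show "?M i j < ?M i (Suc j)"
    proof (cases "i = Suc N")
      case True
      then show ?thesis using ij b by (auto simp: gog_row_def strict_mono_on_def)
    next
      case False
      then show ?thesis using ij D(5)[of i j] by simp
    qed
  qed
  then show ?thesis by (simp add: gog_bottom_def)
qed

lemma finite_gog_bottom: "finite (gog_bottom m n k b)"
  by (simp add: gog_bottom_def finite_gog_trapezoids)

lemma card_gog_bottom_Suc:
  assumes k: "k \<le> Suc N" and b: "gog_row m k b"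
  defines "r \<equiv> min k N"
  shows "card (gog_bottom m (Suc N) k b) =
    (\<Sum>l\<in>interlacing r (bottom_ext m k b). card (gog_bottom (Suc m) N r l))"
proof -
  let ?I = "interlacing r (bottom_ext m k b)"
  let ?f = "\<lambda>M :: nat \<Rightarrow> nat \<Rightarrow> nat. M(Suc N := (\<lambda>_. 0))"
    and ?g = "\<lambda>M :: nat \<Rightarrow> nat \<Rightarrow> nat. M(Suc N := (\<lambda>j. if j \<in> {1..k} then b j else 0))"
  have "bij_betw ?f (gog_bottom m (Suc N) k b) (\<Union>l\<in>?I. gog_bottom (Suc m) N r l)"
  proof (rule bij_betw_byWitness[of _ ?g])
    show "\<forall>M\<in>gog_bottom m (Suc N) k b. ?g (?f M) = M"
    proof
      fix M assume "M \<in> gog_bottom m (Suc N) k b"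
      then have "M (Suc N) j = (if j \<in> {1..k} then b j else 0)" for j
        using gog_trapezoidsD(1)[of M m "Suc N" k "Suc N" j] by (auto simp: gog_bottom_def)
      then show "?g (?f M) = M" by (auto simp: fun_eq_iff)
    qed
    show "\<forall>M\<in>\<Union>l\<in>?I. gog_bottom (Suc m) N r l. ?f (?g M) = M"
    proof
      fix M assume "M \<in> (\<Union>l\<in>?I. gog_bottom (Suc m) N r l)"
      then have "M (Suc N) j = 0" for j
        using gog_trapezoidsD(1)[of M "Suc m" N r "Suc N" j] by (auto simp: gog_bottom_def)
      then show "?f (?g M) = M" by (auto simp: fun_eq_iff)
    qed
    show "?f ` gog_bottom m (Suc N) k b \<subseteq> (\<Union>l\<in>?I. gog_bottom (Suc m) N r l)"
      using gog_remove_bottom[OF k] by (force simp: r_def gog_bottom_def[of _ _ "min k N"])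
    show "?g ` (\<Union>l\<in>?I. gog_bottom (Suc m) N r l) \<subseteq> gog_bottom m (Suc N) k b"
      using gog_add_bottom[OF k b] by (auto simp: r_def)
  qed
  then have "card (gog_bottom m (Suc N) k b) = card (\<Union>l\<in>?I. gog_bottom (Suc m) N r l)"
    by (rule bij_betw_same_card)
  also have "\<dots> = (\<Sum>l\<in>?I. card (gog_bottom (Suc m) N r l))"
  proof (rule card_UN_disjoint)
    show "\<forall>l\<in>?I. \<forall>l'\<in>?I. l \<noteq> l' \<longrightarrow> gog_bottom (Suc m) N r l \<inter> gog_bottom (Suc m) N r l' = {}"
    proof (intro ballI impI)
      fix l l' assume l: "l \<in> ?I" "l' \<in> ?I" "l \<noteq> l'"
      then obtain j where j: "l j \<noteq> l' j" by (auto simp: fun_eq_iff)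
      \<comment> \<open>Both rows are zero outside \<open>{1..r}\<close>, so they differ at an index
        where row \<open>N\<close> of a trapezoid is prescribed.\<close>
      then have "j \<in> {1..r}" using l by (cases "j \<in> {1..r}") (auto simp: interlacing_def)
      then show "gog_bottom (Suc m) N r l \<inter> gog_bottom (Suc m) N r l' = {}"
        using j by (auto simp: gog_bottom_def)
    qed
  qed (simp_all add: finite_interlacing finite_gog_bottom)
  finally show ?thesis .
qed

lemma weighted_ct_bottom_Suc:
  assumes k: "k \<le> Suc N" and b: "gog_row m k b"
  defines "r \<equiv> min k N"
  shows "weighted_ct (Suc N) (bottom_ext m k b) (bottom_exp (Suc N) k) =
    (\<Sum>l\<in>interlacing r (bottom_ext m k b). weighted_ct N (bottom_ext (Suc m) r l) (bottom_exp N r))"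
proof -
  let ?a = "bottom_ext m k b" and ?e = "bottom_exp (Suc N) k"
  \<comment> \<open>\<open>?c\<close> is the padding value increased by the \<open>Suc\<close> from
    the elimination. It agrees with the padding for \<open>Suc m\<close> and \<open>r\<close> when
    \<open>r = k\<close>; otherwise \<open>r = N\<close> and no index up to \<open>N\<close> exceeds
    \<open>r\<close>.\<close>
  let ?c = "\<lambda>i :: nat. Suc (Suc (m + k))" and ?d = "\<lambda>i. if i \<le> r then - int N else int i - int N - int k"
  have "weighted_ct (Suc N) ?a ?e = (\<Sum>p | p \<in> {1..Suc N} \<and> ?e p = - int N. (- 1) ^ (p - 1) *
      weighted_ct N (\<lambda>i. if i < p then ?a i else Suc (?a (Suc i))) (\<lambda>i. if i < p then ?e i else ?e (Suc i)))"
    by (rule weighted_ct_Suc) (simp add: bottom_exp_def)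
  \<comment> \<open>The second branch of \<open>bottom_exp\<close> also gives \<open>- int N\<close>
    at index \<open>k + 1\<close>, so one index beyond \<open>k\<close> contributes if it
    exists.\<close>
  also have "{p. p \<in> {1..Suc N} \<and> ?e p = - int N} = {1..Suc r}"
    using k by (auto simp: bottom_exp_def r_def)
  also have "(\<Sum>p=1..Suc r. (- 1) ^ (p - 1) *
      weighted_ct N (\<lambda>i. if i < p then ?a i else Suc (?a (Suc i))) (\<lambda>i. if i < p then ?e i else ?e (Suc i))) =
    (\<Sum>p=1..Suc r. (- 1) ^ (p - 1) *
      weighted_ct N (\<lambda>i. if i \<le> r then if i < p then ?a i else Suc (?a (Suc i)) else ?c i) ?d)"
    using k by (intro sum.cong refl arg_cong2[of _ _ _ _ "(*)"] weighted_ct_cong)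
      (auto simp: bottom_ext_def bottom_exp_def r_def)
  also have "\<dots> = (\<Sum>l\<in>interlacing r ?a. weighted_ct N (\<lambda>i. if i \<le> r then l i else ?c i) (\<lambda>i. if i \<le> r then ?d i + 1 else ?d i))"
  proof (rule alt_sum_ct_eq_row_sum_ct)
    show "strict_mono_on {1..Suc r} ?a"
      using strict_mono_on_bottom_ext[OF b] by (rule monotone_on_subset) (auto simp: r_def)
  qed (auto simp: r_def)
  also have "\<dots> = (\<Sum>l\<in>interlacing r ?a. weighted_ct N (bottom_ext (Suc m) r l) (bottom_exp N r))"
    by (intro sum.cong refl weighted_ct_cong) (auto simp: bottom_ext_def bottom_exp_def r_def)
  finally show ?thesis .
qed

lemma card_gog_bottom:
  assumes "k \<le> n" "gog_row m k b"
  shows "int (card (gog_bottom m n k b)) = weighted_ct n (bottom_ext m k b) (bottom_exp n k)"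
  using assms
proof (induction n arbitrary: m k b)
  case 0
  then have "gog_bottom m 0 k b = {\<lambda>_ _. 0}"
    by (auto simp: gog_bottom_def gog_trapezoids_def fun_eq_iff)
  then show ?case
    by (simp add: weighted_ct_def weight_def pair_kernel_def vander_def ordered_pairs_def constant_term_def)
next
  case (Suc N)
  let ?r = "min k N"
  have "int (card (gog_bottom (Suc m) N ?r l)) = weighted_ct N (bottom_ext (Suc m) ?r l) (bottom_exp N ?r)"
    if "l \<in> interlacing ?r (bottom_ext m k b)" for l
    using Suc.prems that by (intro Suc.IH gog_row_interlacing) simp_all
  then show ?case
    using Suc.prems by (simp add: card_gog_bottom_Suc weighted_ct_bottom_Suc)
qed

lemma card_gog_bottom_eq_constant_term:
  assumes "k \<le> n" "gog_row m k b"
  shows "int (card {M \<in> gog_trapezoids m n k. \<forall>j\<in>{1..k}. M n j = b j}) = constant_term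
    ((\<Prod>i=1..k. (1 + X i) ^ b i * xpow i (- int n + 1)) *
     (\<Prod>i=k+1..n. (1 + X i) ^ (m + k + 1) * xpow i (- int n + int i - int k)) *
     (\<Prod>(i, j)\<in>{(i, j). 1 \<le> i \<and> i < j \<and> j \<le> n}. (X i - X j) * (1 + X j + X i * X j)))"
proof -
  have split: "{1..n} = {1..k} \<union> {k+1..n}" using assms(1) by auto
  have "weight (bottom_ext m k b) (bottom_exp n k) {1..n} =
      (\<Prod>i=1..k. (1 + X i) ^ b i * xpow i (- int n + 1)) *
      (\<Prod>i=k+1..n. (1 + X i) ^ (m + k + 1) * xpow i (- int n + int i - int k))"
    unfolding weight_def split
    by (subst prod.union_disjoint)
      (auto simp: bottom_ext_def bottom_exp_def algebra_simps intro!: arg_cong2[of _ _ _ _ "(*)"] prod.cong)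
  moreover have "pair_kernel {1..n} =
      (\<Prod>(i, j)\<in>{(i, j). 1 \<le> i \<and> i < j \<and> j \<le> n}. (X i - X j) * (1 + X j + X i * X j))"
  proof -
    have "ordered_pairs {1..n} = {(i, j). 1 \<le> i \<and> i < j \<and> j \<le> n}" by (auto simp: ordered_pairs_def)
    then show ?thesis
      by (simp add: pair_kernel_def vander_def quad_def case_prod_beta prod.distrib)
  qed
  ultimately show ?thesis
    using card_gog_bottom[OF assms] by (simp only: weighted_ct_def gog_bottom_def)
qed

text \<open>For \<open>m = 0\<close> the entry bound in row \<open>n\<close> is exactly
  \<open>j\<close>, while strict increase from a positive first entry gives at least
  \<open>j\<close>.\<close>

lemma gog_bottom_row_eq:
  assumes "k \<le> n" "M \<in> gog_trapezoids 0 n k" "j \<in> {1..k}"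
  shows "M n j = j"
proof (rule antisym)
  have "1 \<le> n" using assms by auto
  then show "M n j \<le> j" using assms gog_trapezoidsD(2)[OF assms(2), of n j] by simp
  have "1 \<le> j" "j \<le> k" using assms(3) by auto
  then show "j \<le> M n j"
  proof (induction j rule: dec_induct)
    case base
    then show ?case using \<open>1 \<le> n\<close> gog_trapezoidsD(2)[OF assms(2), of n 1] by simp
  next
    case (step j)
    then have "M n j < M n (Suc j)"
      using assms(1) by (intro gog_trapezoidsD(5)[OF assms(2)]) simp_all
    then show ?case using step by simp
  qed
qed

theorem theorem3p1:
  fixes m n k :: nat
  assumes "k \<le> n"
  shows
    "(\<forall>b :: nat \<Rightarrow> nat.
        (\<forall>i\<in>{1..k}. 0 < b i) \<and> strict_mono_on {1..k} b \<and> (1 \<le> k \<longrightarrow> b k \<le> m + k) \<longrightarrow>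
        int (card {M \<in> gog_trapezoids m n k. \<forall>j\<in>{1..k}. M n j = b j}) =
        constant_term
          ((\<Prod>i=1..k. (1 + X i) ^ b i * xpow i (- int n + 1)) *
           (\<Prod>i=k+1..n. (1 + X i) ^ (m + k + 1) * xpow i (- int n + int i - int k)) *
           (\<Prod>(i, j)\<in>{(i, j). 1 \<le> i \<and> i < j \<and> j \<le> n}. (X i - X j) * (1 + X j + X i * X j)))) \<and>
     (\<forall>M\<in>gog_trapezoids 0 n k. \<forall>j\<in>{1..k}. M n j = j) \<and>
     int (card (gog_trapezoids 0 n k)) =
       constant_term
         ((\<Prod>i=1..k. (1 + X i) ^ i * xpow i (- int n + 1)) *
          (\<Prod>i=k+1..n. (1 + X i) ^ (k + 1) * xpow i (- int n + int i - int k)) *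
          (\<Prod>(i, j)\<in>{(i, j). 1 \<le> i \<and> i < j \<and> j \<le> n}. (X i - X j) * (1 + X j + X i * X j)))"
proof (intro conjI allI impI, goal_cases)
  case (1 b)
  then have "gog_row m k b" unfolding gog_row_def .
  then show ?case by (rule card_gog_bottom_eq_constant_term[OF assms])
next
  case 2
  show ?case using gog_bottom_row_eq[OF assms] by blast
next
  case 3
  have "{M \<in> gog_trapezoids 0 n k. \<forall>j\<in>{1..k}. M n j = j} = gog_trapezoids 0 n k"
    using gog_bottom_row_eq[OF assms] by auto
  moreover have "gog_row 0 k (\<lambda>i. i)"
    by (simp add: gog_row_def strict_mono_on_def)
  ultimately show ?case
    using card_gog_bottom_eq_constant_term[OF assms, of 0 "\<lambda>i. i"] by (simp only: add_0)
qed

end
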